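(* Let $a,b\in I$ with $a<b$, let $\alpha,\beta\in\mathbb{R}$, and consider the variational problem of minimizing or maximizing $$\mathcal{L}[y]=\int_a^b f\bigl(t,y(qt^n),D_{n,q}y(t)\bigr)\,d_{n,q}t$$ over all $y\in\mathbb{E}([a,b]_{n,q},\mathbb{R})$ satisfying the boundary conditions $y(a)=\alpha$ and $y(b)=\beta$, where $f:[a,b]_{n,q}\times\mathbb{R}\times\mathbb{R}\to\mathbb{R}$ and the problem satisfies the standing assumptions (A1)–(A5) listed in the context. Suppose that $\tilde y$ is an optimal path (a local minimizer or a local maximizer) for this problem. Then $$D_{n,q}\,\partial_3 f\bigl(t,\tilde y(qt^n),D_{n,q}\tilde y(t)\bigr)=\partial_2 f\bigl(t,\tilde y(qt^n),D_{n,q}\tilde y(t)\bigr)\qquad\text{for all } t\in[a,b]_{n,q},$$ where the left-hand side is the $n,q$-derivative of the function $t\mapsto \partial_3 f(t,\tilde y(qt^n),D_{n,q}\tilde y(t))$.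
   Context: Fix $0<q<1$ and an odd positive integer $n$. Put $\theta=\infty$ if $n=1$ and $\theta=q^{1/(1-n)}$ if $n\ge 3$; $S=\{0\}$ if $n=1$ and $S=\{-\theta,0,\theta\}$ if $n\ge 3$; $I=(-\theta,\theta)$; $[0]_n=0$ and $[k]_n=\sum_{i=0}^{k-1}n^i$ for $k\ge 1$. Power difference operator: $D_{n,q}y(t)=\dfrac{y(qt^n)-y(t)}{qt^n-t}$ if $t\notin S$, and $D_{n,q}y(t)=y'(t)$ if $t\in S$ (provided the derivative exists). For functions defined only on $[a,b]_{n,q}$ (below) the same formula is used, the derivative at $0$ being the limit of difference quotients through points of $[a,b]_{n,q}$. Power integral: for $x\in I$, $$\int_0^x u(t)\,d_{n,q}t=-\sum_{k=0}^\infty q^{[k]_n}x^{n^k}\bigl(q^{n^k}x^{n^k(n-1)}-1\bigr)u\bigl(q^{[k]_n}x^{n^k}\bigr),$$ and $\int_a^b u\,d_{n,q}t=\int_0^b u\,d_{n,q}t-\int_0^a u\,d_{n,q}t$. All series that occur are assumed convergent. Sets and spaces: $[s]_{n,q}=\{q^{[k]_n}s^{n^k}:k\in\mathbb{N}_0\}$ for $s\in I$, and $[a,b]_{n,q}=[a]_{n,q}\cup[b]_{n,q}\cup\{0\}$. $\mathcal{D}([a,b]_{n,q},\mathbb{R})$ is the set of continuous bounded real functions on $[a,b]_{n,q}$. $\mathbb{E}([a,b]_{n,q},\mathbb{R})$ is the linear space of $y\in\mathcal{D}([a,b]_{n,q},\mathbb{R})$ whose $n,q$-derivative is continuous and bounded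 on $[a,b]_{n,q}$, with norm $\|y\|_1=\sup_{t\in[a,b]_{n,q}}|y(t)|+\sup_{t\in[a,b]_{n,q}}|D_{n,q}y(t)|$. A function $y\in\mathbb{E}([a,b]_{n,q},\mathbb{R})$ is admissible if $y(a)=\alpha$, $y(b)=\beta$; $p\in\mathbb{E}([a,b]_{n,q},\mathbb{R})$ is an admissible variation if $p(a)=p(b)=0$. An admissible $\tilde y$ is a local minimizer (resp. local maximizer) if there is $\delta>0$ with $\mathcal{L}[\tilde y]\le\mathcal{L}[y]$ (resp. $\ge$) for all admissible $y$ with $\|y-\tilde y\|_1<\delta$. $\partial_2f,\partial_3f$ are the partial derivatives of $f$ in its second and third arguments. A function $g:[s]_{n,q}\times(-\bar\varepsilon,\bar\varepsilon)\to\mathbb{R}$ is such that $g(t,\cdot)$ is differentiable at $\varepsilon_0$ uniformly in $t\in[s]_{n,q}$ if for every $\eta>0$ there is $\delta>0$ such that $0<|\varepsilon-\varepsilon_0|<\delta$ implies $\left|\frac{g(t,\varepsilon)-g(t,\varepsilon_0)}{\varepsilon-\varepsilon_0}-\partial_2g(t,\varepsilon_0)\right|<\eta$ for all $t\in[s]_{n,q}$, where $\partial_2 g=\partial g/\partial\varepsilon$. Standing assumptions: (A1) $(u,v)\mapsto f(t,u,v)$ is $C^1(\mathbb{R}^2,\mathbb{R})$ for every $t\in[a,b]_{n,q}$. (A2) $f(\cdot,y(\cdot),D_{n,q}y(\cdot))$, $\partial_2f(\cdot,y(\cdot),D_{n,q}y(\cdot))$ and $\partial_3f(\cdot,y(\cdot),D_{n,q}y(\cdot))$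 are continuous and bounded on $[a,b]_{n,q}$ for all admissible $y$. For all admissible $y$ and admissible variations $p$, with $g(t,\varepsilon)=f(t,y(qt^n)+\varepsilon p(qt^n),D_{n,q}y(t)+\varepsilon D_{n,q}p(t))$, $\varepsilon\in(-\bar\varepsilon,\bar\varepsilon)$: (A3) $g(t,\cdot)$ is differentiable at $0$ uniformly in $t\in[a]_{n,q}$, and also uniformly in $t\in[b]_{n,q}$. (A4) $\int_0^a g(t,\varepsilon)\,d_{n,q}t$ and $\int_0^b g(t,\varepsilon)\,d_{n,q}t$ exist for $\varepsilon$ near $0$. (A5) $\int_0^a\partial_2g(t,0)\,d_{n,q}t$ and $\int_0^b\partial_2g(t,0)\,d_{n,q}t$ exist.
   Formalization: False as stated; two hypotheses are added: [a]_{n,q} and [b]_{n,q} meet at most in 0, and, if a=0 or b=0, t ↦ ∂₂f(t,ỹ(qtⁿ),D_{n,q}ỹ(t)) and t ↦ ∂₃f(t,ỹ(qtⁿ),D_{n,q}ỹ(t)) are continuous on [a,b]_{n,q}. *)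

theory Defs
  imports "HOL-Analysis.Analysis"
begin

definition nq_theta :: "nat \<Rightarrow> real \<Rightarrow> ereal" where
  "nq_theta n q = (if n = 1 then \<infinity> else ereal (q powr (1 / (1 - real n))))"

(* For n = 1 the two infinite values are not real, so this is {0}. *)
definition nq_S :: "nat \<Rightarrow> real \<Rightarrow> real set" where
  "nq_S n q = {t. ereal t \<in> {- nq_theta n q, 0, nq_theta n q}}"

definition nq_I :: "nat \<Rightarrow> real \<Rightarrow> real set" where
  "nq_I n q = {t. - nq_theta n q < ereal t \<and> ereal t < nq_theta n q}"

definition nq_bracket :: "nat \<Rightarrow> nat \<Rightarrow> nat" where
  "nq_bracket n k = (\<Sum>i<k. n ^ i)"

definition nq_orbit :: "nat \<Rightarrow> real \<Rightarrow> real \<Rightarrow> real set" where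
  "nq_orbit n q s = range (\<lambda>k. q ^ nq_bracket n k * s ^ (n ^ k))"

definition nq_interval :: "nat \<Rightarrow> real \<Rightarrow> real \<Rightarrow> real \<Rightarrow> real set" where
  "nq_interval n q a b = nq_orbit n q a \<union> nq_orbit n q b \<union> {0}"

(* A is the domain of y.  At the points of S the derivative is the ordinary one, taken as the
   limit of difference quotients through points of A. *)
definition has_nq_deriv ::
    "nat \<Rightarrow> real \<Rightarrow> real set \<Rightarrow> (real \<Rightarrow> real) \<Rightarrow> real \<Rightarrow> real \<Rightarrow> bool" where
  "has_nq_deriv n q A y d t \<longleftrightarrow>
     (if t \<in> nq_S n q then (y has_real_derivative d) (at t within A)
      else d = (y (q * t ^ n) - y t) / (q * t ^ n - t))"

definition nq_differentiable ::
    "nat \<Rightarrow> real \<Rightarrow> real set \<Rightarrow> (real \<Rightarrow> real) \<Rightarrow> real \<Rightarrow> bool" where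
  "nq_differentiable n q A y t \<longleftrightarrow> (\<exists>d. has_nq_deriv n q A y d t)"

definition nq_deriv ::
    "nat \<Rightarrow> real \<Rightarrow> real set \<Rightarrow> (real \<Rightarrow> real) \<Rightarrow> real \<Rightarrow> real" where
  "nq_deriv n q A y t = (THE d. has_nq_deriv n q A y d t)"

definition nq_term :: "nat \<Rightarrow> real \<Rightarrow> real \<Rightarrow> (real \<Rightarrow> real) \<Rightarrow> nat \<Rightarrow> real" where
  "nq_term n q x u k =
     q ^ nq_bracket n k * x ^ (n ^ k) * (q ^ (n ^ k) * x ^ (n ^ k * (n - 1)) - 1)
       * u (q ^ nq_bracket n k * x ^ (n ^ k))"

definition nq_integrable0 :: "nat \<Rightarrow> real \<Rightarrow> real \<Rightarrow> (real \<Rightarrow> real) \<Rightarrow> bool" where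
  "nq_integrable0 n q x u \<longleftrightarrow> summable (nq_term n q x u)"

definition nq_integral0 :: "nat \<Rightarrow> real \<Rightarrow> real \<Rightarrow> (real \<Rightarrow> real) \<Rightarrow> real" where
  "nq_integral0 n q x u = - (\<Sum>k. nq_term n q x u k)"

definition nq_integral :: "nat \<Rightarrow> real \<Rightarrow> real \<Rightarrow> real \<Rightarrow> (real \<Rightarrow> real) \<Rightarrow> real" where
  "nq_integral n q a b u = nq_integral0 n q b u - nq_integral0 n q a u"

(* Real functions on the (n,q)-interval are represented by total functions; nothing below
   depends on their values elsewhere, since t \<mapsto> q * t ^ n maps the interval into itself. *)
definition nq_D_space :: "nat \<Rightarrow> real \<Rightarrow> real \<Rightarrow> real \<Rightarrow> (real \<Rightarrow> real) set" where
  "nq_D_space n q a b =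
     {y. continuous_on (nq_interval n q a b) y \<and> bounded (y ` nq_interval n q a b)}"

definition nq_E_space :: "nat \<Rightarrow> real \<Rightarrow> real \<Rightarrow> real \<Rightarrow> (real \<Rightarrow> real) set" where
  "nq_E_space n q a b =
     {y \<in> nq_D_space n q a b.
        (\<forall>t\<in>nq_interval n q a b. nq_differentiable n q (nq_interval n q a b) y t) \<and>
        nq_deriv n q (nq_interval n q a b) y \<in> nq_D_space n q a b}"

definition nq_norm1 :: "nat \<Rightarrow> real \<Rightarrow> real \<Rightarrow> real \<Rightarrow> (real \<Rightarrow> real) \<Rightarrow> real" where
  "nq_norm1 n q a b y =
     (SUP t\<in>nq_interval n q a b. \<bar>y t\<bar>) +
     (SUP t\<in>nq_interval n q a b. \<bar>nq_deriv n q (nq_interval n q a b) y t\<bar>)"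

definition nq_admissible ::
    "nat \<Rightarrow> real \<Rightarrow> real \<Rightarrow> real \<Rightarrow> real \<Rightarrow> real \<Rightarrow> (real \<Rightarrow> real) \<Rightarrow> bool" where
  "nq_admissible n q a b \<alpha> \<beta> y \<longleftrightarrow> y \<in> nq_E_space n q a b \<and> y a = \<alpha> \<and> y b = \<beta>"

definition nq_variation ::
    "nat \<Rightarrow> real \<Rightarrow> real \<Rightarrow> real \<Rightarrow> (real \<Rightarrow> real) \<Rightarrow> bool" where
  "nq_variation n q a b p \<longleftrightarrow> p \<in> nq_E_space n q a b \<and> p a = 0 \<and> p b = 0"

definition nq_L ::
    "nat \<Rightarrow> real \<Rightarrow> real \<Rightarrow> real \<Rightarrow> (real \<Rightarrow> real \<Rightarrow> real \<Rightarrow> real) \<Rightarrow> (real \<Rightarrow> real) \<Rightarrow> real" where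
  "nq_L n q a b f y =
     nq_integral n q a b
       (\<lambda>t. f t (y (q * t ^ n)) (nq_deriv n q (nq_interval n q a b) y t))"

definition nq_local_minimizer ::
    "nat \<Rightarrow> real \<Rightarrow> real \<Rightarrow> real \<Rightarrow> real \<Rightarrow> real \<Rightarrow> (real \<Rightarrow> real \<Rightarrow> real \<Rightarrow> real) \<Rightarrow>
     (real \<Rightarrow> real) \<Rightarrow> bool" where
  "nq_local_minimizer n q a b \<alpha> \<beta> f y0 \<longleftrightarrow>
     nq_admissible n q a b \<alpha> \<beta> y0 \<and>
     (\<exists>\<delta>>0. \<forall>y. nq_admissible n q a b \<alpha> \<beta> y \<and> nq_norm1 n q a b (\<lambda>t. y t - y0 t) < \<delta> \<longrightarrow>
        nq_L n q a b f y0 \<le> nq_L n q a b f y)"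

definition nq_local_maximizer ::
    "nat \<Rightarrow> real \<Rightarrow> real \<Rightarrow> real \<Rightarrow> real \<Rightarrow> real \<Rightarrow> (real \<Rightarrow> real \<Rightarrow> real \<Rightarrow> real) \<Rightarrow>
     (real \<Rightarrow> real) \<Rightarrow> bool" where
  "nq_local_maximizer n q a b \<alpha> \<beta> f y0 \<longleftrightarrow>
     nq_admissible n q a b \<alpha> \<beta> y0 \<and>
     (\<exists>\<delta>>0. \<forall>y. nq_admissible n q a b \<alpha> \<beta> y \<and> nq_norm1 n q a b (\<lambda>t. y t - y0 t) < \<delta> \<longrightarrow>
        nq_L n q a b f y0 \<ge> nq_L n q a b f y)"

definition partial2 :: "(real \<Rightarrow> real \<Rightarrow> real \<Rightarrow> real) \<Rightarrow> real \<Rightarrow> real \<Rightarrow> real \<Rightarrow> real" where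
  "partial2 f t u v = deriv (\<lambda>w. f t w v) u"

definition partial3 :: "(real \<Rightarrow> real \<Rightarrow> real \<Rightarrow> real) \<Rightarrow> real \<Rightarrow> real \<Rightarrow> real \<Rightarrow> real" where
  "partial3 f t u v = deriv (\<lambda>w. f t u w) v"

definition C1_plane :: "(real \<times> real \<Rightarrow> real) \<Rightarrow> bool" where
  "C1_plane h \<longleftrightarrow>
     (\<exists>h' :: real \<times> real \<Rightarrow> (real \<times> real) \<Rightarrow>\<^sub>L real.
        (\<forall>x. (h has_derivative blinfun_apply (h' x)) (at x)) \<and> continuous_on UNIV h')"

(* Here g is defined for every real value of its second argument; restricting that argument
   to an open interval around e0 would not change the notion. *)
definition unif_differentiable_at ::
    "real set \<Rightarrow> (real \<Rightarrow> real \<Rightarrow> real) \<Rightarrow> real \<Rightarrow> bool" where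
  "unif_differentiable_at X g e0 \<longleftrightarrow>
     (\<forall>t\<in>X. g t field_differentiable at e0) \<and>
     (\<forall>\<eta>>0. \<exists>\<delta>>0. \<forall>e. 0 < \<bar>e - e0\<bar> \<and> \<bar>e - e0\<bar> < \<delta> \<longrightarrow>
        (\<forall>t\<in>X. \<bar>(g t e - g t e0) / (e - e0) - deriv (g t) e0\<bar> < \<eta>))"

definition nq_g ::
    "nat \<Rightarrow> real \<Rightarrow> real \<Rightarrow> real \<Rightarrow> (real \<Rightarrow> real \<Rightarrow> real \<Rightarrow> real) \<Rightarrow>
     (real \<Rightarrow> real) \<Rightarrow> (real \<Rightarrow> real) \<Rightarrow> real \<Rightarrow> real \<Rightarrow> real" where
  "nq_g n q a b f y p t e =
     f t (y (q * t ^ n) + e * p (q * t ^ n))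
       (nq_deriv n q (nq_interval n q a b) y t + e * nq_deriv n q (nq_interval n q a b) p t)"

end

theory Submission imports Defs
begin

text \<open>
Write \<open>\<phi> t = q * t ^ n\<close>.  On the set \<open>A\<close> this map moves every nonzero point strictly closer to \<open>0\<close> and
keeps its sign, so \<open>A\<close> consists of \<open>0\<close> and the \<open>\<phi>\<close>-orbits of the two endpoints, which run into
\<open>0\<close>, and away from \<open>0\<close> it is discrete.  The power integral over an orbit is \<open>\<Sum>k. (t\<^sub>k - t\<^sub>k\<^sub>+\<^sub>1) * u t\<^sub>k\<close> with
\<open>t\<^sub>k\<^sub>+\<^sub>1 = \<phi> t\<^sub>k\<close>.

At \<open>t \<noteq> 0\<close> the equation is the vanishing of the first variation in the direction of the one-point
bump at \<open>\<phi> t\<close>.  This bump is an admissible variation, because a point of the form \<open>\<phi> t\<close> with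
\<open>t \<noteq> 0\<close> is never an endpoint, and it changes only the two terms of the functional that belong to
\<open>t\<close> and \<open>\<phi> t\<close>; differentiating these two terms gives the equation at \<open>t\<close>
(\<open>euler_lagrange_nonzero\<close>).

At \<open>0\<close> the derivative is an ordinary limit.  A function that is continuous at \<open>0\<close> and whose
\<open>\<phi>\<close>-difference quotients tend to \<open>d\<close> has derivative \<open>d\<close> there, by telescoping along the orbits
(\<open>derivative_at_0_of_quotient\<close>).  The equation at the nonzero points says that the quotients of
\<open>\<partial>\<^sub>3f\<close> along the optimal path are the values of \<open>\<partial>\<^sub>2f\<close>, so it remains to know that both partial
derivatives along the path are continuous at \<open>0\<close>.

This continuity is a hypothesis when an endpoint is \<open>0\<close>, and the delicate point otherwise.  The standing assumptions give
convergence along \<open>(t, y t, D y t)\<close>, whereas the functional looks at \<open>(t, y (\<phi> t), D y t)\<close>.  The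
second arguments differ by a quantity that tends to \<open>0\<close>, but the convergence
of \<open>f t\<close> as \<open>t\<close> tends to \<open>0\<close> is only pointwise, so that such a shift may matter.  Adding to \<open>y\<close> a constant \<open>e\<close>
near \<open>0\<close> gives convergence of \<open>f t (y t + e) (D y t)\<close> for every real \<open>e\<close>, and the Baire category
theorem then provides, up to any prescribed error, a dense set of \<open>e\<close> at which the shifted functions
have the same limit (\<open>Baire_shifted_limit\<close>).  Uniform differentiability in \<open>e\<close> transports both the
limit of the values and that of the derivatives from nearby \<open>e\<close> to \<open>e = 0\<close>
(\<open>limits_of_uniformly_differentiable_family\<close>).  This settles the Lagrangian itself and \<open>\<partial>\<^sub>2f\<close>, for
every admissible \<open>y\<close>.  Applied to the paths \<open>y + e * p\<close> with \<open>p t = t\<close> near \<open>0\<close>, the limit of the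
Lagrangian gives the limit of \<open>\<partial>\<^sub>3f\<close> by the same transport.
\<close>

section \<open>Orbits of the power map\<close>

definition nq_map :: "nat \<Rightarrow> real \<Rightarrow> real \<Rightarrow> real" where
  "nq_map n q t = q * t ^ n"

lemma nq_orbit_point: "q ^ nq_bracket n k * s ^ (n ^ k) = (nq_map n q ^^ k) s"
proof (induction k)
  case 0
  then show ?case by (simp add: nq_bracket_def)
next
  case (Suc k)
  have "nq_bracket n (Suc k) = 1 + nq_bracket n k * n"
    unfolding nq_bracket_def by (subst sum.lessThan_Suc_shift) (simp add: sum_distrib_left mult.commute)
  then have "q ^ nq_bracket n (Suc k) * s ^ (n ^ Suc k) = nq_map n q (q ^ nq_bracket n k * s ^ (n ^ k))"
    by (simp add: nq_map_def power_mult_distrib power_mult[symmetric] power_add mult.commute)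
  then show ?case using Suc by simp
qed

lemma nq_orbit_eq: "nq_orbit n q s = range (\<lambda>k. (nq_map n q ^^ k) s)"
  unfolding nq_orbit_def nq_orbit_point ..

text \<open>
In terms of the orbit the defining series of the power integral is a Riemann sum, and exponents
disappear from all later arguments.
\<close>

lemma nq_term_eq:
  assumes "0 < n"
  shows "nq_term n q s u k =
    ((nq_map n q ^^ Suc k) s - (nq_map n q ^^ k) s) * u ((nq_map n q ^^ k) s)"
proof -
  have "n ^ k + n ^ k * (n - 1) = n ^ Suc k"
    using assms by (cases n) auto
  then have "s ^ (n ^ k) * s ^ (n ^ k * (n - 1)) = s ^ (n ^ Suc k)"
    by (metis power_add)
  moreover have "nq_bracket n (Suc k) = nq_bracket n k + n ^ k"
    by (simp add: nq_bracket_def)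
  ultimately have "q ^ nq_bracket n k * s ^ (n ^ k) * (q ^ (n ^ k) * s ^ (n ^ k * (n - 1))) =
      (nq_map n q ^^ Suc k) s"
    unfolding nq_orbit_point[symmetric] by (simp add: power_add mult_ac)
  then show ?thesis
    unfolding nq_term_def nq_orbit_point[symmetric] by (simp add: right_diff_distrib)
qed

locale nq_pair =
  fixes n :: nat and q a b :: real
  assumes q: "0 < q" "q < 1" and n: "odd n"
    and ab: "a \<in> nq_I n q" "b \<in> nq_I n q" "a < b"
    and orbits: "nq_orbit n q a \<inter> nq_orbit n q b \<subseteq> {0}"
begin

abbreviation "\<phi> \<equiv> nq_map n q"
abbreviation "A \<equiv> nq_interval n q a b"
abbreviation "Dnq \<equiv> nq_deriv n q A"
abbreviation "near0 \<equiv> at 0 within A"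

text \<open>
The expression defining the derivative at the points outside the exceptional set.  At \<open>0\<close> it has the
value \<open>0\<close>, division by zero, and is used only through its limit.
\<close>

definition quot :: "(real \<Rightarrow> real) \<Rightarrow> real \<Rightarrow> real" where
  "quot y t = (y (\<phi> t) - y t) / (\<phi> t - t)"

lemma n_pos: "0 < n"
  using n by (rule odd_pos)

lemma map_0 [simp]: "\<phi> 0 = 0"
  using n_pos by (simp add: nq_map_def)

lemma map_eq_0_iff [simp]: "\<phi> t = 0 \<longleftrightarrow> t = 0"
  using n_pos q by (simp add: nq_map_def)

lemma iterate_eq_0_iff [simp]: "(\<phi> ^^ k) t = 0 \<longleftrightarrow> t = 0"
  by (induction k) auto

text \<open>
The endpoint \<open>\<theta>\<close> of the interval is the positive fixed point of \<open>\<phi>\<close> if \<open>n \<ge> 3\<close>; inside the interval the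
factor by which \<open>\<phi>\<close> scales absolute values is below \<open>1\<close>.
\<close>

lemma nq_I_contraction: "t \<in> nq_I n q \<Longrightarrow> q * \<bar>t\<bar> ^ (n - 1) < 1"
proof (cases "n = 1")
  case True
  then show ?thesis using q by simp
next
  case False
  assume "t \<in> nq_I n q"
  then have "\<bar>t\<bar> < q powr (1 / (1 - real n))"
    using False by (auto simp: nq_I_def nq_theta_def)
  then have "\<bar>t\<bar> ^ (n - 1) < (q powr (1 / (1 - real n))) ^ (n - 1)"
    using False n_pos by (intro power_strict_mono) auto
  also have "\<dots> = q powr (real (n - 1) * (1 / (1 - real n)))"
    using q by (simp add: powr_realpow[symmetric] powr_powr mult.commute)
  also have "real (n - 1) * (1 / (1 - real n)) = - 1"
    using False n_pos by (simp add: of_nat_diff field_simps)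
  finally show ?thesis using q by (simp add: powr_minus field_simps)
qed

lemma abs_map: "\<bar>\<phi> t\<bar> = (q * \<bar>t\<bar> ^ (n - 1)) * \<bar>t\<bar>"
  using n_pos q by (cases n) (simp_all add: nq_map_def abs_mult power_abs)

lemma abs_map_less: "\<lbrakk>t \<in> nq_I n q; t \<noteq> 0\<rbrakk> \<Longrightarrow> \<bar>\<phi> t\<bar> < \<bar>t\<bar>"
  using nq_I_contraction[of t] unfolding abs_map by simp

lemma nq_I_downward: "\<lbrakk>t \<in> nq_I n q; \<bar>s\<bar> \<le> \<bar>t\<bar>\<rbrakk> \<Longrightarrow> s \<in> nq_I n q"
  by (auto simp: nq_I_def nq_theta_def split: if_splits)

lemma map_in_I: "t \<in> nq_I n q \<Longrightarrow> \<phi> t \<in> nq_I n q"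
  using abs_map_less nq_I_downward by (metis less_imp_le map_0)

lemma iterate_in_I: "t \<in> nq_I n q \<Longrightarrow> (\<phi> ^^ k) t \<in> nq_I n q"
  by (induction k) (auto intro: map_in_I)

lemma abs_map_diff: "t \<in> nq_I n q \<Longrightarrow> \<bar>\<phi> t - t\<bar> = \<bar>t\<bar> - \<bar>\<phi> t\<bar>"
proof -
  assume t: "t \<in> nq_I n q"
  have "0 \<le> \<phi> t * t"
    using n q by (cases "0 \<le> t") (auto simp: nq_map_def zero_le_mult_iff mult_le_0_iff power_le_zero_eq)
  then show ?thesis
    using abs_map_less[OF t] by (cases "t = 0") (auto simp: abs_if zero_le_mult_iff split: if_splits)
qed

lemma iterate_tendsto_0:
  assumes "s \<in> nq_I n q"
  shows "(\<lambda>k. (\<phi> ^^ k) s) \<longlonglongrightarrow> 0"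
proof -
  define r where "r = q * \<bar>s\<bar> ^ (n - 1)"
  have r: "0 \<le> r" "r < 1" using nq_I_contraction[OF assms] q by (auto simp: r_def)
  have "norm ((\<phi> ^^ k) s) \<le> r ^ k * \<bar>s\<bar>" for k
  proof (induction k)
    case (Suc k)
    then have IH: "\<bar>(\<phi> ^^ k) s\<bar> \<le> r ^ k * \<bar>s\<bar>" by simp
    have "r ^ k * \<bar>s\<bar> \<le> \<bar>s\<bar>" using r by (simp add: mult_left_le_one_le power_le_one)
    then have "q * \<bar>(\<phi> ^^ k) s\<bar> ^ (n - 1) \<le> r"
      unfolding r_def using IH q by (intro mult_left_mono power_mono) (auto simp: r_def)
    then have "\<bar>(\<phi> ^^ Suc k) s\<bar> \<le> r * (r ^ k * \<bar>s\<bar>)"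
      using IH r by (auto simp: abs_map intro!: mult_mono)
    then show ?case by simp
  qed simp
  then have bound: "\<forall>\<^sub>F k in sequentially. norm ((\<phi> ^^ k) s) \<le> r ^ k * \<bar>s\<bar>"
    by (intro always_eventually allI)
  have "(\<lambda>k. r ^ k * \<bar>s\<bar>) \<longlonglongrightarrow> 0"
    using r by (intro tendsto_mult_left_zero LIMSEQ_power_zero) auto
  with bound show ?thesis by (rule Lim_null_comparison)
qed

lemma abs_iterate_strict_antimono:
  assumes "s \<in> nq_I n q" "s \<noteq> 0" "j < k"
  shows "\<bar>(\<phi> ^^ k) s\<bar> < \<bar>(\<phi> ^^ j) s\<bar>"
  using assms(3)
proof (induction k)
  case (Suc k)
  have "\<bar>(\<phi> ^^ Suc k) s\<bar> < \<bar>(\<phi> ^^ k) s\<bar>"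
    using assms iterate_in_I[of s k] by (auto intro: abs_map_less)
  then show ?case using Suc by (cases "j = k") auto
qed simp

lemma iterate_eq_iff:
  "\<lbrakk>s \<in> nq_I n q; s \<noteq> 0\<rbrakk> \<Longrightarrow> (\<phi> ^^ j) s = (\<phi> ^^ k) s \<longleftrightarrow> j = k"
  by (metis abs_iterate_strict_antimono less_irrefl nat_neq_iff)

lemma in_A_iff: "t \<in> A \<longleftrightarrow> t = 0 \<or> (\<exists>s\<in>{a, b}. \<exists>k. t = (\<phi> ^^ k) s)"
  by (auto simp: nq_interval_def nq_orbit_eq)

lemma ends_in_I: "s \<in> {a, b} \<Longrightarrow> s \<in> nq_I n q"
  using ab by auto

lemma zero_in_A [simp]: "0 \<in> A"
  by (simp add: in_A_iff)

lemma iterate_end_in_A: "s \<in> {a, b} \<Longrightarrow> (\<phi> ^^ k) s \<in> A"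
  by (auto simp: in_A_iff)

lemma A_subset_I: "t \<in> A \<Longrightarrow> t \<in> nq_I n q"
  using ab iterate_in_I nq_I_downward[of a 0] by (auto simp: in_A_iff)

lemma map_in_A [simp]: "t \<in> A \<Longrightarrow> \<phi> t \<in> A"
  unfolding in_A_iff by (metis funpow.simps(2) map_0 o_apply)

lemma iterate_in_A: "t \<in> A \<Longrightarrow> (\<phi> ^^ k) t \<in> A"
  by (induction k) auto

lemma map_neq: "\<lbrakk>t \<in> A; t \<noteq> 0\<rbrakk> \<Longrightarrow> \<phi> t \<noteq> t"
  using abs_map_less[OF A_subset_I] by fastforce

text \<open>
Along its own orbit an endpoint does not recur, and the orbit of the other endpoint avoids it
by disjointness.  This makes a bump at \<open>\<phi> t\<close> vanish at both endpoints.
\<close>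

lemma map_notin_ends: "\<lbrakk>t \<in> A; t \<noteq> 0\<rbrakk> \<Longrightarrow> \<phi> t \<notin> {a, b}"
proof
  assume t: "t \<in> A" "t \<noteq> 0" and e: "\<phi> t \<in> {a, b}"
  obtain s k where s: "s \<in> {a, b}" "t = (\<phi> ^^ k) s" using t by (auto simp: in_A_iff)
  have s0: "s \<noteq> 0" using t s by auto
  have eq: "\<phi> t = (\<phi> ^^ Suc k) s" using s by simp
  have "\<phi> t = s"
  proof (rule ccontr)
    assume "\<phi> t \<noteq> s"
    then have "{\<phi> t, s} = {a, b}" using e s by auto
    moreover have "\<phi> t \<in> nq_orbit n q s" unfolding nq_orbit_eq using eq by (rule range_eqI)
    moreover have "\<phi> t \<in> nq_orbit n q (\<phi> t)"
      unfolding nq_orbit_eq by (rule range_eqI[of _ _ 0]) simp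
    ultimately have "\<phi> t \<in> nq_orbit n q a \<inter> nq_orbit n q b"
      by (auto simp: doubleton_eq_iff)
    then have "\<phi> t = 0" using orbits by blast
    then show False using t by simp
  qed
  then show False
    using iterate_eq_iff[of s "Suc k" 0] s s0 eq ends_in_I by auto
qed

lemma A_dist_0_finite:
  assumes "0 < \<delta>"
  shows "finite {t \<in> A. \<delta> \<le> \<bar>t\<bar>}"
proof -
  have "finite {k. \<delta> \<le> \<bar>(\<phi> ^^ k) s\<bar>}" if "s \<in> {a, b}" for s
  proof -
    have "\<forall>\<^sub>F k in sequentially. \<bar>(\<phi> ^^ k) s\<bar> < \<delta>"
      using tendstoD[OF iterate_tendsto_0[OF ends_in_I[OF that]] assms] by (simp add: dist_real_def)
    then have "\<forall>\<^sub>F k in cofinite. \<not> \<delta> \<le> \<bar>(\<phi> ^^ k) s\<bar>"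
      by (simp add: cofinite_eq_sequentially not_le)
    then show ?thesis by (simp add: eventually_cofinite)
  qed
  then have "finite (\<Union>s\<in>{a, b}. (\<lambda>k. (\<phi> ^^ k) s) ` {k. \<delta> \<le> \<bar>(\<phi> ^^ k) s\<bar>})"
    by blast
  moreover have "{t \<in> A. \<delta> \<le> \<bar>t\<bar>} \<subseteq>
      (\<Union>s\<in>{a, b}. (\<lambda>k. (\<phi> ^^ k) s) ` {k. \<delta> \<le> \<bar>(\<phi> ^^ k) s\<bar>})"
    using assms by (auto simp: in_A_iff)
  ultimately show ?thesis by (rule finite_subset[rotated])
qed

lemma isolated_in_A:
  assumes "t \<noteq> 0"
  shows "at t within A = bot"
proof -
  have "finite (A \<inter> ball t (\<bar>t\<bar> / 2))"
    using assms by (intro finite_subset[OF _ A_dist_0_finite[of "\<bar>t\<bar> / 2"]])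
      (auto simp: dist_real_def abs_if split: if_splits)
  then have "\<not> t islimpt A"
    using assms by (auto simp: islimpt_eq_infinite_ball intro!: exI[of _ "\<bar>t\<bar> / 2"])
  then show ?thesis using trivial_limit_within by blast
qed

lemma near0_neq_bot: "near0 \<noteq> bot"
proof -
  obtain s where s: "s \<in> {a, b}" "s \<noteq> 0" using ab by (cases "a = 0") auto
  have "\<forall>k. (\<phi> ^^ k) s \<in> A - {0}" using s iterate_end_in_A by auto
  moreover have "(\<lambda>k. (\<phi> ^^ k) s) \<longlonglongrightarrow> 0" using s by (intro iterate_tendsto_0 ends_in_I)
  ultimately have "0 islimpt A"
    unfolding islimpt_sequential by (intro exI[of _ "\<lambda>k. (\<phi> ^^ k) s"]) auto
  then show ?thesis using trivial_limit_within by blast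
qed

lemma eventually_near0: "\<forall>\<^sub>F t in near0. t \<in> A \<and> t \<noteq> 0"
  unfolding eventually_at by (auto intro: exI[of _ 1])

lemma map_near0: "filterlim \<phi> near0 near0"
proof -
  have "\<forall>\<^sub>F t in near0. norm (\<phi> t) \<le> \<bar>t\<bar>"
    using eventually_near0 by eventually_elim (auto dest!: A_subset_I abs_map_less)
  moreover have "((\<lambda>t. \<bar>t\<bar>) \<longlongrightarrow> 0) near0" by (auto intro!: tendsto_eq_intros)
  ultimately have "(\<phi> \<longlongrightarrow> 0) near0" by (rule Lim_null_comparison)
  then show ?thesis
    using eventually_near0 by (auto simp: filterlim_at elim: eventually_mono)
qed

lemma iterate_near0: "\<lbrakk>t \<in> A; t \<noteq> 0\<rbrakk> \<Longrightarrow> filterlim (\<lambda>k. (\<phi> ^^ k) t) near0 sequentially"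
  using iterate_tendsto_0[OF A_subset_I] iterate_in_A by (auto simp: filterlim_at)

section \<open>Derivatives and spaces of paths\<close>

text \<open>
If the quotients are within \<open>\<eta>\<close> of \<open>d\<close>, then one step of \<open>\<phi>\<close> changes \<open>y t - d * t\<close> by at most \<open>\<eta>\<close> times
the length of the step.  The steps of an orbit all point towards \<open>0\<close>, so their lengths add up to at
most \<open>\<bar>t\<bar>\<close>, and continuity at \<open>0\<close> evaluates the limit of the telescoping sum.
\<close>

lemma derivative_at_0_of_quotient:
  assumes y: "(y \<longlongrightarrow> y 0) near0" and d: "(quot y \<longlongrightarrow> d) near0"
  shows "(y has_real_derivative d) near0"
proof -
  have "\<forall>\<^sub>F t in near0. \<bar>(y t - y 0) / t - d\<bar> \<le> \<eta>" if \<eta>: "0 < \<eta>" for \<eta>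
  proof -
    obtain \<delta> where \<delta>: "0 < \<delta>" "\<And>t. \<lbrakk>t \<in> A; t \<noteq> 0; \<bar>t\<bar> < \<delta>\<rbrakk> \<Longrightarrow> \<bar>quot y t - d\<bar> < \<eta>"
      using tendstoD[OF d \<eta>] unfolding eventually_at by (auto simp: dist_real_def)
    define G where "G t = y t - d * t" for t
    have step: "\<bar>G (\<phi> t) - G t\<bar> \<le> \<eta> * (\<bar>t\<bar> - \<bar>\<phi> t\<bar>)" if t: "t \<in> A" "t \<noteq> 0" "\<bar>t\<bar> < \<delta>" for t
    proof -
      have "G (\<phi> t) - G t = (quot y t - d) * (\<phi> t - t)"
        using map_neq[OF t(1,2)] by (simp add: G_def quot_def field_simps)
      also have "\<bar>\<dots>\<bar> \<le> \<eta> * (\<bar>t\<bar> - \<bar>\<phi> t\<bar>)"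
        unfolding abs_mult abs_map_diff[OF A_subset_I[OF t(1)], symmetric]
        using \<delta>(2)[OF t] by (intro mult_right_mono) auto
      finally show ?thesis .
    qed
    have "\<bar>(y t - y 0) / t - d\<bar> \<le> \<eta>" if t: "t \<in> A" "t \<noteq> 0" "\<bar>t\<bar> < \<delta>" for t
    proof -
      have tele: "\<bar>G ((\<phi> ^^ m) t) - G t\<bar> \<le> \<eta> * (\<bar>t\<bar> - \<bar>(\<phi> ^^ m) t\<bar>)" for m
      proof (induction m)
        case (Suc m)
        have "\<bar>(\<phi> ^^ m) t\<bar> \<le> \<bar>t\<bar>"
          using abs_iterate_strict_antimono[of t 0 m] t A_subset_I by (cases "m = 0") auto
        then have "\<bar>G ((\<phi> ^^ Suc m) t) - G ((\<phi> ^^ m) t)\<bar> \<le> \<eta> * (\<bar>(\<phi> ^^ m) t\<bar> - \<bar>(\<phi> ^^ Suc m) t\<bar>)"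
          using step[of "(\<phi> ^^ m) t"] t iterate_in_A by auto
        then show ?case using Suc by (simp add: algebra_simps abs_if split: if_splits)
      qed simp
      have bound: "\<bar>G ((\<phi> ^^ m) t) - G t\<bar> \<le> \<eta> * \<bar>t\<bar>" for m
        using tele[of m] \<eta> by (smt (verit) mult_left_mono)
      have "(G \<longlongrightarrow> y 0) near0"
        unfolding G_def by (rule tendsto_eq_intros y refl | simp)+
      then have "(\<lambda>m. G ((\<phi> ^^ m) t)) \<longlonglongrightarrow> y 0"
        using iterate_near0[OF t(1,2)] by (rule filterlim_compose)
      then have "(\<lambda>m. \<bar>G ((\<phi> ^^ m) t) - G t\<bar>) \<longlonglongrightarrow> \<bar>y 0 - G t\<bar>"
        by (intro tendsto_intros)
      then have "\<bar>y 0 - G t\<bar> \<le> \<eta> * \<bar>t\<bar>"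
        using bound by (intro Lim_bounded) auto
      moreover have "(y t - y 0) / t - d = (G t - y 0) / t"
        using t by (simp add: G_def field_simps)
      ultimately show ?thesis
        using t by (simp add: abs_divide abs_minus_commute divide_le_eq)
    qed
    then show ?thesis unfolding eventually_at using \<delta>(1) by (auto simp: dist_real_def)
  qed
  note bound = this
  have "((\<lambda>t. (y t - y 0) / t) \<longlongrightarrow> d) near0"
  proof (rule tendstoI)
    fix \<epsilon> :: real assume "0 < \<epsilon>"
    then have "\<forall>\<^sub>F t in near0. \<bar>(y t - y 0) / t - d\<bar> \<le> \<epsilon> / 2" by (intro bound) auto
    then show "\<forall>\<^sub>F t in near0. dist ((y t - y 0) / t) d < \<epsilon>"
      using \<open>0 < \<epsilon>\<close> by (auto simp: dist_real_def elim: eventually_mono)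
  qed
  then show ?thesis by (simp add: has_field_derivative_iff)
qed

lemma zero_in_S: "0 \<in> nq_S n q"
  by (auto simp: nq_S_def zero_ereal_def)

lemma nonzero_notin_S: "\<lbrakk>t \<in> A; t \<noteq> 0\<rbrakk> \<Longrightarrow> t \<notin> nq_S n q"
  using A_subset_I[of t] by (auto simp: nq_S_def nq_I_def)

lemma has_nq_deriv_0: "has_nq_deriv n q A y d 0 \<longleftrightarrow> (y has_real_derivative d) near0"
  by (simp add: has_nq_deriv_def zero_in_S)

lemma has_nq_deriv_nonzero: "\<lbrakk>t \<in> A; t \<noteq> 0\<rbrakk> \<Longrightarrow> has_nq_deriv n q A y d t \<longleftrightarrow> d = quot y t"
  by (simp add: has_nq_deriv_def nonzero_notin_S quot_def nq_map_def)

lemma nq_deriv_nonzero: "\<lbrakk>t \<in> A; t \<noteq> 0\<rbrakk> \<Longrightarrow> Dnq y t = quot y t"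
  by (simp add: nq_deriv_def has_nq_deriv_nonzero)

lemma nq_deriv_0: "(y has_real_derivative d) near0 \<Longrightarrow> Dnq y 0 = d"
  unfolding nq_deriv_def has_nq_deriv_0 using near0_neq_bot
  by (metis (mono_tags, lifting) has_field_derivative_iff tendsto_unique the_equality)

text \<open>
Away from \<open>0\<close> the set \<open>A\<close> is discrete, and outside a neighbourhood of \<open>0\<close> it is finite, so continuity
and boundedness both reduce to the behaviour at \<open>0\<close>.
\<close>

lemma D_space_iff: "y \<in> nq_D_space n q a b \<longleftrightarrow> (y \<longlongrightarrow> y 0) near0"
proof
  assume "y \<in> nq_D_space n q a b"
  then show "(y \<longlongrightarrow> y 0) near0" by (auto simp: nq_D_space_def continuous_on_def)
next
  assume y: "(y \<longlongrightarrow> y 0) near0"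
  then have "continuous_on A y"
    unfolding continuous_on_def by (metis isolated_in_A tendsto_bot)
  moreover obtain \<delta> where \<delta>: "0 < \<delta>" "\<And>t. \<lbrakk>t \<in> A; t \<noteq> 0; \<bar>t\<bar> < \<delta>\<rbrakk> \<Longrightarrow> dist (y t) (y 0) < 1"
    using tendstoD[OF y, of 1] unfolding eventually_at by (auto simp: dist_real_def)
  have "y ` A \<subseteq> y ` {t \<in> A. \<delta> \<le> \<bar>t\<bar>} \<union> cball (y 0) 1"
    using \<delta>(2) by (force simp: dist_commute not_le intro: less_imp_le)
  then have "bounded (y ` A)"
    using A_dist_0_finite[OF \<delta>(1)]
    by (meson bounded_Un bounded_cball bounded_subset finite_imageI finite_imp_bounded)
  ultimately show "y \<in> nq_D_space n q a b" by (simp add: nq_D_space_def)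
qed

text \<open>
With the following converse, membership in the path space depends only on the germ of \<open>y\<close> at \<open>0\<close>;
hence bumps and cutoffs at finitely many nonzero points stay in the space.
\<close>

lemma E_spaceI:
  assumes y: "(y \<longlongrightarrow> y 0) near0" and d: "(quot y \<longlongrightarrow> d) near0"
  shows "y \<in> nq_E_space n q a b"
proof -
  have der: "(y has_real_derivative d) near0"
    using assms by (rule derivative_at_0_of_quotient)
  have "\<forall>\<^sub>F t in near0. quot y t = Dnq y t"
    using eventually_near0 by eventually_elim (simp add: nq_deriv_nonzero)
  then have "(Dnq y \<longlongrightarrow> Dnq y 0) near0"
    using d nq_deriv_0[OF der] by (auto intro: Lim_transform_eventually)
  moreover have "nq_differentiable n q A y t" if "t \<in> A" for t
    using that der unfolding nq_differentiable_def
    by (cases "t = 0") (auto simp: has_nq_deriv_0 has_nq_deriv_nonzero)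
  ultimately show ?thesis
    using y by (simp add: nq_E_space_def D_space_iff)
qed

lemma E_spaceD:
  assumes "y \<in> nq_E_space n q a b"
  shows "(y \<longlongrightarrow> y 0) near0" "(Dnq y \<longlongrightarrow> Dnq y 0) near0" "(quot y \<longlongrightarrow> Dnq y 0) near0"
    "(y has_real_derivative Dnq y 0) near0"
proof -
  show y: "(y \<longlongrightarrow> y 0) near0" and D: "(Dnq y \<longlongrightarrow> Dnq y 0) near0"
    using assms by (auto simp: nq_E_space_def D_space_iff)
  have "\<forall>\<^sub>F t in near0. Dnq y t = quot y t"
    using eventually_near0 by eventually_elim (simp add: nq_deriv_nonzero)
  then show q: "(quot y \<longlongrightarrow> Dnq y 0) near0"
    using D by (rule Lim_transform_eventually[rotated])
  show "(y has_real_derivative Dnq y 0) near0"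
    using y q by (rule derivative_at_0_of_quotient)
qed

lemma E_space_add_scaled:
  assumes y: "y \<in> nq_E_space n q a b" and p: "p \<in> nq_E_space n q a b"
  shows "(\<lambda>t. y t + e * p t) \<in> nq_E_space n q a b"
    and "t \<in> A \<Longrightarrow> Dnq (\<lambda>t. y t + e * p t) t = Dnq y t + e * Dnq p t"
proof -
  have quot: "quot (\<lambda>t. y t + e * p t) = (\<lambda>t. quot y t + e * quot p t)"
    by (auto simp: quot_def fun_eq_iff add_divide_distrib diff_divide_distrib algebra_simps)
  have lim: "((\<lambda>t. y t + e * p t) \<longlongrightarrow> y 0 + e * p 0) near0"
    "(quot (\<lambda>t. y t + e * p t) \<longlongrightarrow> Dnq y 0 + e * Dnq p 0) near0"
    unfolding quot by (intro tendsto_intros E_spaceD y p)+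
  then show "(\<lambda>t. y t + e * p t) \<in> nq_E_space n q a b"
    by (rule E_spaceI)
  show "Dnq (\<lambda>t. y t + e * p t) t = Dnq y t + e * Dnq p t" if "t \<in> A"
    using nq_deriv_0[OF derivative_at_0_of_quotient[OF lim]] that
    by (cases "t = 0") (auto simp: nq_deriv_nonzero quot)
qed

lemma E_space_finite_modification:
  assumes y: "y \<in> nq_E_space n q a b" and X: "finite X" "0 \<notin> X"
    and p: "\<And>t. t \<notin> X \<Longrightarrow> p t = y t"
  shows "p \<in> nq_E_space n q a b" "\<forall>\<^sub>F t in near0. p t = y t"
    "\<forall>\<^sub>F t in near0. Dnq p t = Dnq y t" "Dnq p 0 = Dnq y 0"
proof -
  have "\<forall>\<^sub>F t in near0. t \<notin> X"
    using X topological_tendstoD[OF tendsto_ident_at, of "- X" 0 A]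
    by (simp add: finite_imp_closed open_Compl)
  then show ev: "\<forall>\<^sub>F t in near0. p t = y t"
    by eventually_elim (rule p)
  have "\<forall>\<^sub>F t in near0. p (\<phi> t) = y (\<phi> t)"
    using ev map_near0 by (rule eventually_compose_filterlim)
  have ev': "\<forall>\<^sub>F t in near0. y t = p t"
    using ev by eventually_elim simp
  from ev \<open>\<forall>\<^sub>F t in near0. p (\<phi> t) = y (\<phi> t)\<close> have quot: "\<forall>\<^sub>F t in near0. quot y t = quot p t"
    by eventually_elim (simp add: quot_def)
  have 0: "p 0 = y 0" using X p by simp
  have p0: "(p \<longlongrightarrow> p 0) near0"
    unfolding 0 using E_spaceD(1)[OF y] ev' by (rule Lim_transform_eventually)
  moreover have pq: "(quot p \<longlongrightarrow> Dnq y 0) near0"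
    using E_spaceD(3)[OF y] quot by (rule Lim_transform_eventually)
  ultimately show "p \<in> nq_E_space n q a b" by (rule E_spaceI)
  show "Dnq p 0 = Dnq y 0"
    using p0 pq by (intro nq_deriv_0 derivative_at_0_of_quotient)
  show "\<forall>\<^sub>F t in near0. Dnq p t = Dnq y t"
    using quot eventually_near0 by eventually_elim (simp add: nq_deriv_nonzero)
qed

lemma const_in_E_space: "(\<lambda>t. c) \<in> nq_E_space n q a b" and nq_deriv_const: "t \<in> A \<Longrightarrow> Dnq (\<lambda>t. c) t = 0"
proof -
  have q: "quot (\<lambda>t. c) = (\<lambda>t. 0)" by (simp add: quot_def fun_eq_iff)
  then show "(\<lambda>t. c) \<in> nq_E_space n q a b" by (intro E_spaceI[of _ 0]) auto
  have "Dnq (\<lambda>t. c) 0 = 0" by (rule nq_deriv_0) simp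
  then show "t \<in> A \<Longrightarrow> Dnq (\<lambda>t. c) t = 0"
    by (cases "t = 0") (auto simp: nq_deriv_nonzero q)
qed

lemma id_in_E_space: "(\<lambda>t. t) \<in> nq_E_space n q a b" and nq_deriv_id: "t \<in> A \<Longrightarrow> Dnq (\<lambda>t. t) t = 1"
proof -
  have q: "t \<in> A \<Longrightarrow> t \<noteq> 0 \<Longrightarrow> quot (\<lambda>t. t) t = 1" for t by (simp add: quot_def map_neq)
  have "\<forall>\<^sub>F t in near0. 1 = quot (\<lambda>t. t) t"
    using eventually_near0 by eventually_elim (simp add: q)
  then have "(quot (\<lambda>t. t) \<longlongrightarrow> 1) near0"
    by (rule Lim_transform_eventually[OF tendsto_const])
  then show "(\<lambda>t. t) \<in> nq_E_space n q a b" by (intro E_spaceI) auto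
  have "Dnq (\<lambda>t. t) 0 = 1" by (rule nq_deriv_0) simp
  then show "t \<in> A \<Longrightarrow> Dnq (\<lambda>t. t) t = 1"
    by (cases "t = 0") (auto simp: nq_deriv_nonzero q)
qed

end

section \<open>Limits of families of functions of a parameter\<close>

text \<open>
Pointwise convergence alone does not survive a vanishing shift of the argument.  By the Baire
category theorem, though, pointwise convergence of continuous functions is uniform up to any given
error \<open>\<eta>\<close> on some small interval inside \<open>{l<..<r}\<close>, and in the interior of that interval a small
shift is harmless.
\<close>

lemma Baire_shifted_limit:
  fixes A :: "real set" and \<Phi> :: "real \<Rightarrow> real \<Rightarrow> real"
  assumes lim: "\<And>e. ((\<lambda>t. \<Phi> t e) \<longlongrightarrow> \<psi> e) (at 0 within A)"
    and cont_\<Phi>: "\<And>t. t \<in> A \<Longrightarrow> continuous_on UNIV (\<Phi> t)"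
    and cont_\<psi>: "continuous_on UNIV \<psi>"
    and d: "(d \<longlongrightarrow> 0) (at 0 within A)"
    and "l < r" "0 < \<eta>"
  shows "\<exists>e\<in>{l<..<r}. \<forall>\<^sub>F t in at 0 within A. \<bar>\<Phi> t (e + d t) - \<psi> e\<bar> < \<eta>"
proof -
  define E where "E m = {l..r} \<inter>
    (\<Inter>t\<in>{t\<in>A. t \<noteq> 0 \<and> \<bar>t\<bar> < 1 / real (Suc m)}. {e. \<bar>\<Phi> t e - \<psi> e\<bar> \<le> \<eta> / 2})" for m
  have "closed {e. \<bar>\<Phi> t e - \<psi> e\<bar> \<le> \<eta> / 2}" if "t \<in> A" for t
    using cont_\<Phi>[OF that] cont_\<psi> by (intro closed_Collect_le continuous_intros)
  then have closed_E: "closed (E m)" for m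
    unfolding E_def by (intro closed_Int closed_INT) auto
  have "e \<in> (\<Union>m. E m)" if e: "e \<in> {l..r}" for e
  proof -
    have "\<forall>\<^sub>F t in at 0 within A. \<bar>\<Phi> t e - \<psi> e\<bar> < \<eta> / 2"
      using tendstoD[OF lim, of "\<eta>/2" e] \<open>0 < \<eta>\<close> by (simp add: dist_real_def)
    then obtain \<delta> where \<delta>: "\<delta> > 0" "\<And>t. \<lbrakk>t \<in> A; t \<noteq> 0; \<bar>t\<bar> < \<delta>\<rbrakk> \<Longrightarrow> \<bar>\<Phi> t e - \<psi> e\<bar> < \<eta> / 2"
      unfolding eventually_at by (auto simp: dist_real_def)
    obtain m where "1 / real (Suc m) < \<delta>"
      using nat_approx_posE[OF \<delta>(1)] by blast
    then have "e \<in> E m" using e \<delta>(2) unfolding E_def by (fastforce intro: less_imp_le)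
    then show ?thesis by blast
  qed
  then have "{l<..<r} \<subseteq> interior (\<Union>m. E m)"
    by (intro interior_maximal) auto
  then have "interior (\<Union> (range E)) \<noteq> {}"
    using \<open>l < r\<close> by force
  then obtain m where "interior (E m) \<noteq> {}"
    using Baire_category_alt[of euclidean "range E"] closed_E completely_metrizable_space_euclidean
    by auto
  then obtain e where e: "e \<in> interior (E m)" by blast
  have "interior (E m) \<subseteq> interior {l..r}"
    by (intro interior_mono) (auto simp: E_def)
  then have "e \<in> {l<..<r}" using e by auto
  moreover have "\<forall>\<^sub>F t in at 0 within A. \<bar>\<Phi> t (e + d t) - \<psi> e\<bar> < \<eta>"
  proof -
    have shift: "((\<lambda>t. e + d t) \<longlongrightarrow> e) (at 0 within A)"
      using tendsto_add[OF tendsto_const d] by simp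
    then have "\<forall>\<^sub>F t in at 0 within A. e + d t \<in> interior (E m)"
      using e by (auto dest: topological_tendstoD)
    moreover have "((\<lambda>t. \<psi> (e + d t)) \<longlongrightarrow> \<psi> e) (at 0 within A)"
      using cont_\<psi> shift by (auto intro: continuous_on_tendsto_compose)
    then have "\<forall>\<^sub>F t in at 0 within A. \<bar>\<psi> (e + d t) - \<psi> e\<bar> < \<eta> / 2"
      using tendstoD[of _ "\<psi> e" _ "\<eta>/2"] \<open>0 < \<eta>\<close> by (simp add: dist_real_def)
    moreover have "\<forall>\<^sub>F t in at 0 within A. t \<in> A \<and> t \<noteq> 0 \<and> \<bar>t\<bar> < 1 / real (Suc m)"
      unfolding eventually_at by (intro exI[of _ "1 / real (Suc m)"]) (auto simp: dist_real_def)
    ultimately show ?thesis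
    proof eventually_elim
      case (elim t)
      then have "e + d t \<in> E m" using interior_subset by blast
      then have "\<bar>\<Phi> t (e + d t) - \<psi> (e + d t)\<bar> \<le> \<eta> / 2"
        using elim unfolding E_def by blast
      then show ?case using elim by linarith
    qed
  qed
  ultimately show ?thesis by blast
qed

text \<open>
Put \<open>X = g t 0 - \<psi> 0\<close> and \<open>Y = g' t - \<psi>'\<close>.  Comparing the first-order expansions of \<open>g t\<close> and \<open>\<psi>\<close>
shows that \<open>X + e * Y\<close> is small relative to \<open>e\<close>, for all \<open>e\<close> at which \<open>g t e\<close> is close to
\<open>\<psi> e\<close>.  Two such \<open>e\<close> of opposite sign and comparable size force \<open>Y\<close>, and then \<open>X\<close>, to be small.  Only
approximate agreement on a dense set of \<open>e\<close> enters, which is what a Baire argument can deliver.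
\<close>

lemma limits_of_uniformly_differentiable_family:
  fixes g :: "'t \<Rightarrow> real \<Rightarrow> real"
  assumes unif: "\<And>\<eta>. 0 < \<eta> \<Longrightarrow> \<exists>\<delta>>0. \<forall>e. 0 < \<bar>e\<bar> \<and> \<bar>e\<bar> < \<delta> \<longrightarrow>
      (\<forall>\<^sub>F t in F. \<bar>(g t e - g t 0) / e - g' t\<bar> < \<eta>)"
    and approx: "\<And>l r \<eta>. \<lbrakk>l < r; 0 < \<eta>\<rbrakk> \<Longrightarrow>
      \<exists>e\<in>{l<..<r}. \<forall>\<^sub>F t in F. \<bar>g t e - \<psi> e\<bar> < \<eta>"
    and \<psi>: "(\<psi> has_real_derivative \<psi>') (at 0)"
  shows "((\<lambda>t. g t 0) \<longlongrightarrow> \<psi> 0) F" "(g' \<longlongrightarrow> \<psi>') F"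
proof -
  have main: "\<forall>\<^sub>F t in F. \<bar>g t 0 - \<psi> 0\<bar> < \<epsilon> \<and> \<bar>g' t - \<psi>'\<bar> < \<epsilon>" if "0 < \<epsilon>" for \<epsilon>
  proof -
    (* The estimates below give 3 * \<eta> for the derivatives and 6 * \<eta> for the values. *)
    define \<eta> where "\<eta> = \<epsilon> / 8"
    have \<eta>: "0 < \<eta>" using that by (simp add: \<eta>_def)
    obtain \<delta>1 where \<delta>1: "\<delta>1 > 0" "\<And>e. 0 < \<bar>e\<bar> \<and> \<bar>e\<bar> < \<delta>1 \<Longrightarrow>
      \<forall>\<^sub>F t in F. \<bar>(g t e - g t 0) / e - g' t\<bar> < \<eta>"
      using unif[OF \<eta>] by blast
    have "\<exists>\<delta>2>0. \<forall>e. e \<noteq> 0 \<and> \<bar>e\<bar> < \<delta>2 \<longrightarrow> \<bar>(\<psi> e - \<psi> 0) / e - \<psi>'\<bar> < \<eta>"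
      using \<psi> \<eta> unfolding DERIV_def LIM_eq by auto
    then obtain \<delta>2 where \<delta>2: "\<delta>2 > 0"
      "\<And>e. \<lbrakk>e \<noteq> 0; \<bar>e\<bar> < \<delta>2\<rbrakk> \<Longrightarrow> \<bar>(\<psi> e - \<psi> 0) / e - \<psi>'\<bar> < \<eta>"
      by blast
    define \<delta> where "\<delta> = min 1 (min \<delta>1 \<delta>2)"
    have \<delta>: "0 < \<delta>" "\<delta> \<le> 1" "\<delta> \<le> \<delta>1" "\<delta> \<le> \<delta>2" using \<delta>1(1) \<delta>2(1) by (auto simp: \<delta>_def)
    have close: "\<forall>\<^sub>F t in F. \<bar>(g t 0 - \<psi> 0) + e * (g' t - \<psi>')\<bar> < 3 * \<eta> * \<bar>e\<bar>"
      if e: "\<delta> / 2 < \<bar>e\<bar>" "\<bar>e\<bar> < \<delta>" and ev: "\<forall>\<^sub>F t in F. \<bar>g t e - \<psi> e\<bar> < \<eta> * \<delta> / 2" for e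
    proof -
      have e0: "e \<noteq> 0" using e \<delta> by auto
      have scale: "\<bar>x - y * e\<bar> < \<eta> * \<bar>e\<bar>" if "\<bar>x / e - y\<bar> < \<eta>" for x y
      proof -
        have "x - y * e = (x / e - y) * e" using e0 by (simp add: field_simps)
        then show ?thesis using that e0 by (simp add: abs_mult)
      qed
      have \<psi>e: "\<bar>(\<psi> e - \<psi> 0) - \<psi>' * e\<bar> < \<eta> * \<bar>e\<bar>"
        using \<delta>2(2)[of e] e e0 \<delta> by (intro scale) auto
      have "\<forall>\<^sub>F t in F. \<bar>(g t e - g t 0) / e - g' t\<bar> < \<eta>"
        using \<delta>1(2)[of e] e e0 \<delta> by auto
      with ev show ?thesis
      proof eventually_elim
        case (elim t)
        have "\<bar>(g t e - g t 0) - g' t * e\<bar> < \<eta> * \<bar>e\<bar>" using elim by (intro scale) auto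
        moreover have "\<eta> * \<delta> / 2 < \<eta> * \<bar>e\<bar>" using e \<eta> by auto
        moreover have "(g t 0 - \<psi> 0) + e * (g' t - \<psi>') =
            (g t e - \<psi> e) - ((g t e - g t 0) - g' t * e) + ((\<psi> e - \<psi> 0) - \<psi>' * e)"
          by (simp add: algebra_simps)
        ultimately show ?case using elim \<psi>e by linarith
      qed
    qed
    obtain e1 where e1: "\<delta> / 2 < e1" "e1 < \<delta>" "\<forall>\<^sub>F t in F. \<bar>g t e1 - \<psi> e1\<bar> < \<eta> * \<delta> / 2"
      using approx[of "\<delta>/2" \<delta> "\<eta> * \<delta> / 2"] \<eta> \<delta> by auto
    obtain e2 where e2: "- \<delta> < e2" "e2 < - (\<delta> / 2)" "\<forall>\<^sub>F t in F. \<bar>g t e2 - \<psi> e2\<bar> < \<eta> * \<delta> / 2"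
      using approx[of "- \<delta>" "- (\<delta>/2)" "\<eta> * \<delta> / 2"] \<eta> \<delta> by auto
    have "\<forall>\<^sub>F t in F. \<bar>(g t 0 - \<psi> 0) + e1 * (g' t - \<psi>')\<bar> < 3 * \<eta> * \<bar>e1\<bar>"
      using e1 \<delta> by (intro close) auto
    moreover have "\<forall>\<^sub>F t in F. \<bar>(g t 0 - \<psi> 0) + e2 * (g' t - \<psi>')\<bar> < 3 * \<eta> * \<bar>e2\<bar>"
      using e2 \<delta> by (intro close) auto
    ultimately show ?thesis
    proof eventually_elim
      case (elim t)
      define X Y where "X = g t 0 - \<psi> 0" and "Y = g' t - \<psi>'"
      have 1: "\<bar>X + e1 * Y\<bar> < 3 * \<eta> * e1" "\<bar>X + e2 * Y\<bar> < 3 * \<eta> * (- e2)"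
        using elim e1 e2 \<delta> by (auto simp: X_def Y_def)
      have "\<bar>(e1 - e2) * Y\<bar> < 3 * \<eta> * (e1 - e2)"
        using 1 by (simp add: algebra_simps abs_if split: if_splits)
      moreover have "\<bar>(e1 - e2) * Y\<bar> = (e1 - e2) * \<bar>Y\<bar>"
        using e1 e2 \<delta> by (simp add: abs_mult)
      ultimately have "(e1 - e2) * \<bar>Y\<bar> < (e1 - e2) * (3 * \<eta>)"
        by (simp only: mult.commute)
      then have Y: "\<bar>Y\<bar> < 3 * \<eta>" using e1 e2 \<delta> by (simp add: mult_less_cancel_left)
      have "\<bar>e1 * Y\<bar> \<le> 1 * (3 * \<eta>)"
        unfolding abs_mult using e1 \<delta> Y by (intro mult_mono) auto
      moreover have "3 * \<eta> * e1 \<le> 3 * \<eta> * 1" using e1 \<delta> \<eta> by (intro mult_left_mono) auto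
      ultimately have "\<bar>X\<bar> < 8 * \<eta>" using 1 \<eta> by linarith
      then show ?case using Y \<eta> by (simp add: X_def Y_def \<eta>_def)
    qed
  qed
  show "((\<lambda>t. g t 0) \<longlongrightarrow> \<psi> 0) F" "(g' \<longlongrightarrow> \<psi>') F"
    by (rule tendstoI, drule main, simp add: dist_real_def eventually_conj_iff)+
qed

lemma C1_plane_derivative_along_line:
  assumes "C1_plane (\<lambda>(u, v). f t u v)"
  shows "((\<lambda>e. f t (u + e * c) (v + e * d)) has_real_derivative
           partial2 f t u v * c + partial3 f t u v * d) (at 0)"
proof -
  obtain h' where h': "\<And>x. ((\<lambda>(u, v). f t u v) has_derivative blinfun_apply (h' x)) (at x)"
    using assms unfolding C1_plane_def by blast
  define D where "D = blinfun_apply (h' (u, v))"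
  interpret D: bounded_linear D unfolding D_def by (rule blinfun.bounded_linear_right)
  have line: "((\<lambda>e. f t (u + (e - e0) * c) (v + (e - e0) * d)) has_real_derivative D (c, d)) (at e0)"
    for c d e0
  proof -
    have "((\<lambda>e. (\<lambda>(u, v). f t u v) (u + (e - e0) * c, v + (e - e0) * d)) has_derivative
        (\<lambda>e. D (e * c, e * d))) (at e0)"
      unfolding D_def
      by (rule has_derivative_compose[OF _ has_derivative_eq_rhs])
         (auto intro!: derivative_eq_intros h')
    moreover have "(\<lambda>e. D (e * c, e * d)) = (*) (D (c, d))"
      using D.scale[of _ "(c, d)"] by (auto simp: mult.commute)
    ultimately show ?thesis unfolding has_field_derivative_def by simp
  qed
  have "((\<lambda>w. f t w v) has_real_derivative D (1, 0)) (at u)"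
    using line[of u 1 0] by simp
  then have 2: "partial2 f t u v = D (1, 0)" unfolding partial2_def by (rule DERIV_imp_deriv)
  have "((\<lambda>w. f t u w) has_real_derivative D (0, 1)) (at v)"
    using line[of v 0 1] by simp
  then have 3: "partial3 f t u v = D (0, 1)" unfolding partial3_def by (rule DERIV_imp_deriv)
  have "D (c, d) = D (c *\<^sub>R (1, 0) + d *\<^sub>R (0, 1))" by simp
  also have "\<dots> = partial2 f t u v * c + partial3 f t u v * d"
    by (simp only: D.add D.scale 2 3) (simp add: algebra_simps)
  finally show ?thesis using line[of 0 c d] by simp
qed

lemma C1_plane_continuous:
  assumes "C1_plane (\<lambda>(u, v). f t u v)"
    and "continuous_on S h" "continuous_on S k"
  shows "continuous_on S (\<lambda>x. f t (h x) (k x))"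
proof -
  have "continuous_on UNIV (\<lambda>(u, v). f t u v)"
    using assms(1) unfolding C1_plane_def
    by (metis continuous_at_imp_continuous_on has_derivative_continuous)
  then have "continuous_on S (\<lambda>x. (\<lambda>(u, v). f t u v) (h x, k x))"
    by (rule continuous_on_compose2) (auto intro: continuous_intros assms)
  then show ?thesis by simp
qed

section \<open>Integrals and the first variation\<close>

context nq_pair
begin

lemma nq_integral0_cong:
  assumes "s \<in> {a, b}" "\<And>t. t \<in> A \<Longrightarrow> u t = v t"
  shows "nq_integral0 n q s u = nq_integral0 n q s v"
  using assms iterate_end_in_A[OF assms(1)]
  by (simp add: nq_integral0_def nq_term_eq[OF n_pos] del: funpow.simps)

lemma nq_integral0_finite_change:
  assumes "nq_integrable0 n q s u" "finite K"
    and eq: "\<And>k. k \<notin> K \<Longrightarrow> v ((\<phi> ^^ k) s) = u ((\<phi> ^^ k) s)"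
  shows "nq_integral0 n q s v = nq_integral0 n q s u -
    (\<Sum>k\<in>K. ((\<phi> ^^ Suc k) s - (\<phi> ^^ k) s) * (v ((\<phi> ^^ k) s) - u ((\<phi> ^^ k) s)))"
proof -
  define c where "c k = ((\<phi> ^^ Suc k) s - (\<phi> ^^ k) s) * (v ((\<phi> ^^ k) s) - u ((\<phi> ^^ k) s))" for k
  have "c sums sum c K"
    using assms(2) eq by (intro sums_finite) (auto simp: c_def)
  moreover have "nq_term n q s u sums suminf (nq_term n q s u)"
    using assms(1) unfolding nq_integrable0_def by (rule summable_sums)
  ultimately have "(\<lambda>k. nq_term n q s u k + c k) sums (suminf (nq_term n q s u) + sum c K)"
    by (intro sums_add)
  moreover have "nq_term n q s u k + c k = nq_term n q s v k" for k
    unfolding nq_term_eq[OF n_pos] c_def by (simp only: right_diff_distrib)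
  ultimately have "suminf (nq_term n q s v) = suminf (nq_term n q s u) + sum c K"
    by (simp add: sums_unique[symmetric])
  then show ?thesis by (simp add: nq_integral0_def c_def)
qed

text \<open>
Makes \<open>y + e * p\<close> a competitor of a local optimum \<open>y\<close> for all small \<open>e\<close>.
\<close>

lemma nq_norm1_scaled_le:
  assumes p: "p \<in> nq_E_space n q a b"
  shows "\<exists>M>0. \<forall>e. nq_norm1 n q a b (\<lambda>t. e * p t) \<le> \<bar>e\<bar> * M"
proof -
  have "p \<in> nq_D_space n q a b" "Dnq p \<in> nq_D_space n q a b"
    using p by (auto simp: nq_E_space_def)
  then obtain M1 M2 where M: "0 < M1" "0 < M2"
    "\<And>t. t \<in> A \<Longrightarrow> \<bar>p t\<bar> \<le> M1" "\<And>t. t \<in> A \<Longrightarrow> \<bar>Dnq p t\<bar> \<le> M2"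
    by (auto simp: nq_D_space_def bounded_pos)
  have D: "Dnq (\<lambda>t. e * p t) t = e * Dnq p t" if "t \<in> A" for e t
    using E_space_add_scaled(2)[OF const_in_E_space p that, of 0 e] nq_deriv_const[OF that] by simp
  have "A \<noteq> {}" using zero_in_A by blast
  then have "nq_norm1 n q a b (\<lambda>t. e * p t) \<le> \<bar>e\<bar> * M1 + \<bar>e\<bar> * M2" for e
    unfolding nq_norm1_def using M
    by (intro add_mono cSUP_least) (auto simp: abs_mult D intro!: mult_left_mono)
  then show ?thesis using M by (intro exI[of _ "M1 + M2"]) (auto simp: distrib_left)
qed

lemma nq_admissible_perturbed:
  "\<lbrakk>nq_admissible n q a b \<alpha> \<beta> y; nq_variation n q a b p\<rbrakk> \<Longrightarrow>
    nq_admissible n q a b \<alpha> \<beta> (\<lambda>t. y t + e * p t)"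
  by (auto simp: nq_admissible_def nq_variation_def intro: E_space_add_scaled)

lemma nq_g_eq: "nq_g n q a b f y p t e = f t (y (\<phi> t) + e * p (\<phi> t)) (Dnq y t + e * Dnq p t)"
  by (simp add: nq_g_def nq_map_def)

lemma nq_L_perturbed:
  assumes "y \<in> nq_E_space n q a b" "p \<in> nq_E_space n q a b"
  shows "nq_L n q a b f (\<lambda>t. y t + e * p t) = nq_integral n q a b (\<lambda>t. nq_g n q a b f y p t e)"
  unfolding nq_L_def nq_integral_def
  by (intro arg_cong2[of _ _ _ _ "(-)"] nq_integral0_cong)
     (auto simp: nq_g_def E_space_add_scaled[OF assms])

lemma first_variation_eq_0:
  assumes opt: "nq_local_minimizer n q a b \<alpha> \<beta> f y0 \<or> nq_local_maximizer n q a b \<alpha> \<beta> f y0"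
    and p: "nq_variation n q a b p"
    and J: "((\<lambda>e. nq_integral n q a b (\<lambda>t. nq_g n q a b f y0 p t e)) has_real_derivative J') (at 0)"
  shows "J' = 0"
proof -
  have adm: "nq_admissible n q a b \<alpha> \<beta> y0"
    using opt by (auto simp: nq_local_minimizer_def nq_local_maximizer_def)
  have E: "y0 \<in> nq_E_space n q a b" "p \<in> nq_E_space n q a b"
    using adm p by (auto simp: nq_admissible_def nq_variation_def)
  define Y where "Y e = (\<lambda>t. y0 t + e * p t)" for e
  have Y0: "Y 0 = y0" by (simp add: Y_def)
  have J: "((\<lambda>e. nq_L n q a b f (Y e)) has_real_derivative J') (at 0)"
    using J by (simp add: Y_def nq_L_perturbed[OF E])
  obtain M where M: "0 < M" "\<And>e. nq_norm1 n q a b (\<lambda>t. Y e t - y0 t) \<le> \<bar>e\<bar> * M"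
    using nq_norm1_scaled_le[OF E(2)] by (auto simp: Y_def)
  have near: "nq_norm1 n q a b (\<lambda>t. Y e t - y0 t) < \<delta>" if "\<bar>0 - e\<bar> < \<delta> / M" for e \<delta>
    using M(1) M(2)[of e] that by (simp add: less_divide_eq)
  have admY: "nq_admissible n q a b \<alpha> \<beta> (Y e)" for e
    unfolding Y_def using adm p by (rule nq_admissible_perturbed)
  show "J' = 0"
    using opt
  proof
    assume "nq_local_minimizer n q a b \<alpha> \<beta> f y0"
    then obtain \<delta> where \<delta>: "0 < \<delta>" "\<And>y. \<lbrakk>nq_admissible n q a b \<alpha> \<beta> y;
        nq_norm1 n q a b (\<lambda>t. y t - y0 t) < \<delta>\<rbrakk> \<Longrightarrow> nq_L n q a b f y0 \<le> nq_L n q a b f y"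
      by (auto simp: nq_local_minimizer_def)
    show ?thesis
      by (rule DERIV_local_min[OF J, of "\<delta> / M"]) (use \<delta> M near admY in \<open>auto simp: Y0\<close>)
  next
    assume "nq_local_maximizer n q a b \<alpha> \<beta> f y0"
    then obtain \<delta> where \<delta>: "0 < \<delta>" "\<And>y. \<lbrakk>nq_admissible n q a b \<alpha> \<beta> y;
        nq_norm1 n q a b (\<lambda>t. y t - y0 t) < \<delta>\<rbrakk> \<Longrightarrow> nq_L n q a b f y \<le> nq_L n q a b f y0"
      by (auto simp: nq_local_maximizer_def)
    show ?thesis
      by (rule DERIV_local_max[OF J, of "\<delta> / M"]) (use \<delta> M near admY in \<open>auto simp: Y0\<close>)
  qed
qed

text \<open>
Injectivity confines the effect of a bump at \<open>\<phi> t\<close> to the points \<open>t\<close> and \<open>\<phi> t\<close>.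
\<close>

lemma map_inject: "\<phi> x = \<phi> t \<longleftrightarrow> x = t"
  using q odd_real_root_power_cancel[OF n] by (auto simp: nq_map_def) metis

text \<open>
Turns a function with a prescribed germ at \<open>0\<close> into an admissible variation with the same germ.
\<close>

lemma cutoff_variation:
  assumes "0 \<notin> {a, b}" and w: "w \<in> nq_E_space n q a b"
    and p: "\<And>t. p t = (if t \<in> {a, b} then 0 else w t)"
  shows "nq_variation n q a b p" "\<forall>\<^sub>F t in near0. p t = w t"
    "\<forall>\<^sub>F t in near0. Dnq p t = Dnq w t" "p 0 = w 0" "Dnq p 0 = Dnq w 0"
  using E_space_finite_modification[OF w, of "{a, b}" p] assms(1)
  by (auto simp: nq_variation_def p)

end

section \<open>The Euler-Lagrange equation\<close>

locale nq_problem = nq_pair +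
  fixes \<alpha> \<beta> :: real and f :: "real \<Rightarrow> real \<Rightarrow> real \<Rightarrow> real"
  assumes f_C1: "\<And>t. t \<in> A \<Longrightarrow> C1_plane (\<lambda>(u, v). f t u v)"
    and f_path: "\<And>y. nq_admissible n q a b \<alpha> \<beta> y \<Longrightarrow>
      (\<lambda>t. f t (y t) (Dnq y t)) \<in> nq_D_space n q a b"
    and g_unif: "\<And>y p s. \<lbrakk>nq_admissible n q a b \<alpha> \<beta> y; nq_variation n q a b p; s \<in> {a, b}\<rbrakk> \<Longrightarrow>
      unif_differentiable_at (nq_orbit n q s) (nq_g n q a b f y p) 0"
    and g_integrable: "\<And>y p s. \<lbrakk>nq_admissible n q a b \<alpha> \<beta> y; nq_variation n q a b p; s \<in> {a, b}\<rbrakk> \<Longrightarrow>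
      \<forall>\<^sub>F e in nhds 0. nq_integrable0 n q s (\<lambda>t. nq_g n q a b f y p t e)"
begin

text \<open>
The partial derivatives of the integrand along the path \<open>y\<close>, with the second argument evaluated at
\<open>\<phi> t\<close> as in the functional.
\<close>

definition f2 :: "(real \<Rightarrow> real) \<Rightarrow> real \<Rightarrow> real" where
  "f2 y t = partial2 f t (y (\<phi> t)) (Dnq y t)"

definition f3 :: "(real \<Rightarrow> real) \<Rightarrow> real \<Rightarrow> real" where
  "f3 y t = partial3 f t (y (\<phi> t)) (Dnq y t)"

lemma g_has_derivative:
  assumes "t \<in> A"
  shows "(nq_g n q a b f y p t has_real_derivative f2 y t * p (\<phi> t) + f3 y t * Dnq p t) (at 0)"
  using C1_plane_derivative_along_line[where f = f and t = t, OF f_C1[OF assms]]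
  unfolding nq_g_eq[abs_def] f2_def f3_def .

text \<open>
With the bump \<open>p\<close> at \<open>\<phi> t\<close>, the functional of \<open>y0 + e * p\<close> differs from that of \<open>y0\<close> by two terms
of the series over the orbit through \<open>t\<close>.  The term at \<open>t\<close> contributes
\<open>(\<phi> t - t) * f2 y0 t + f3 y0 t\<close> to the derivative, the term at \<open>\<phi> t\<close> contributes \<open>- f3 y0 (\<phi> t)\<close>, and
their sum has to vanish.
\<close>

lemma euler_lagrange_nonzero:
  assumes opt: "nq_local_minimizer n q a b \<alpha> \<beta> f y0 \<or> nq_local_maximizer n q a b \<alpha> \<beta> f y0"
    and t: "t \<in> A" "t \<noteq> 0"
  shows "quot (f3 y0) t = f2 y0 t"
proof -
  have adm: "nq_admissible n q a b \<alpha> \<beta> y0"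
    using opt by (auto simp: nq_local_minimizer_def nq_local_maximizer_def)
  obtain s j where s: "s \<in> {a, b}" "t = (\<phi> ^^ j) s" using t by (auto simp: in_A_iff)
  have s0: "s \<noteq> 0" using t s by auto
  have t1: "\<phi> t \<in> A" "\<phi> t \<noteq> 0" "\<phi> t \<noteq> t" "\<phi> (\<phi> t) \<noteq> \<phi> t"
    using t map_neq[of t] map_neq[of "\<phi> t"] by auto
  define p where "p x = (if x = \<phi> t then 1 else 0 :: real)" for x
  have p_E: "p \<in> nq_E_space n q a b" "Dnq p 0 = 0"
    using E_space_finite_modification[OF const_in_E_space[of 0], of "{\<phi> t}" p] t nq_deriv_const[of 0 0]
    by (auto simp: p_def)
  have p: "nq_variation n q a b p"
    using p_E map_notin_ends[OF t] by (auto simp: nq_variation_def p_def)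
  have Dp: "Dnq p t = 1 / (\<phi> t - t)" "Dnq p (\<phi> t) = - 1 / (\<phi> (\<phi> t) - \<phi> t)"
    using t t1 by (auto simp: nq_deriv_nonzero quot_def p_def)
  have Dp_0: "Dnq p x = 0" if "x \<in> A" "x \<notin> {t, \<phi> t}" for x
    using that p_E by (cases "x = 0") (auto simp: nq_deriv_nonzero quot_def p_def map_inject)
  let ?g = "nq_g n q a b f y0 p"
  have g_const: "?g x e = ?g x 0" if "x \<in> A" "x \<notin> {t, \<phi> t}" for x e
    using that by (simp add: nq_g_eq Dp_0[OF that] p_def map_inject)
  define Q where "Q e = (\<phi> t - t) * (?g t e - ?g t 0) +
    (\<phi> (\<phi> t) - \<phi> t) * (?g (\<phi> t) e - ?g (\<phi> t) 0)" for e
  have int0: "nq_integrable0 n q x (\<lambda>t. ?g t 0)" if "x \<in> {a, b}" for x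
    using eventually_nhds_x_imp_x[OF g_integrable[OF adm p that]] .
  have on_s: "nq_integral0 n q s (\<lambda>t. ?g t e) = nq_integral0 n q s (\<lambda>t. ?g t 0) - Q e" for e
  proof -
    have "nq_integral0 n q s (\<lambda>t. ?g t e) = nq_integral0 n q s (\<lambda>t. ?g t 0) -
      (\<Sum>k\<in>{j, Suc j}. ((\<phi> ^^ Suc k) s - (\<phi> ^^ k) s) *
        (?g ((\<phi> ^^ k) s) e - ?g ((\<phi> ^^ k) s) 0))"
    proof (rule nq_integral0_finite_change[OF int0[OF s(1)]])
      fix k assume "k \<notin> {j, Suc j}"
      then have "(\<phi> ^^ k) s \<notin> {t, \<phi> t}"
        using iterate_eq_iff[OF ends_in_I[OF s(1)] s0, of k j]
          iterate_eq_iff[OF ends_in_I[OF s(1)] s0, of k "Suc j"] s(2) by auto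
      then show "?g ((\<phi> ^^ k) s) e = ?g ((\<phi> ^^ k) s) 0"
        using iterate_end_in_A[OF s(1)] by (rule g_const[rotated])
    qed simp
    then show ?thesis by (simp add: Q_def s(2))
  qed
  have off_s: "nq_integral0 n q s' (\<lambda>t. ?g t e) = nq_integral0 n q s' (\<lambda>t. ?g t 0)"
    if s': "s' \<in> {a, b}" "s' \<noteq> s" for s' e
  proof -
    have "nq_integral0 n q s' (\<lambda>t. ?g t e) = nq_integral0 n q s' (\<lambda>t. ?g t 0) -
      (\<Sum>k\<in>{}. ((\<phi> ^^ Suc k) s' - (\<phi> ^^ k) s') *
        (?g ((\<phi> ^^ k) s') e - ?g ((\<phi> ^^ k) s') 0))"
    proof (rule nq_integral0_finite_change[OF int0[OF s'(1)]])
      fix k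
      have "\<phi> t = (\<phi> ^^ Suc j) s" using s by simp
      then have in_s: "x \<in> {t, \<phi> t} \<Longrightarrow> x \<in> nq_orbit n q s" for x
        using s unfolding nq_orbit_eq by blast
      have in_s': "(\<phi> ^^ k) s' \<in> nq_orbit n q s'" unfolding nq_orbit_eq by blast
      have disjoint: "nq_orbit n q s \<inter> nq_orbit n q s' \<subseteq> {0}"
        using s(1) s' orbits by auto
      have "(\<phi> ^^ k) s' \<notin> {t, \<phi> t}"
      proof
        assume mem: "(\<phi> ^^ k) s' \<in> {t, \<phi> t}"
        with in_s in_s' disjoint have "(\<phi> ^^ k) s' = 0" by blast
        with mem t(2) t1(2) show False by simp
      qed
      then show "?g ((\<phi> ^^ k) s') e = ?g ((\<phi> ^^ k) s') 0"
        using iterate_end_in_A[OF s'(1)] by (rule g_const[rotated])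
    qed simp
    then show ?thesis by simp
  qed
  have "(Q has_real_derivative
      (\<phi> t - t) * (f2 y0 t * p (\<phi> t) + f3 y0 t * Dnq p t - 0) +
      (\<phi> (\<phi> t) - \<phi> t) * (f2 y0 (\<phi> t) * p (\<phi> (\<phi> t)) + f3 y0 (\<phi> t) * Dnq p (\<phi> t) - 0)) (at 0)"
    unfolding Q_def[abs_def]
    by (intro DERIV_add DERIV_cmult DERIV_diff DERIV_const g_has_derivative t t1)
  also have "(\<phi> t - t) * (f2 y0 t * p (\<phi> t) + f3 y0 t * Dnq p t - 0) +
      (\<phi> (\<phi> t) - \<phi> t) * (f2 y0 (\<phi> t) * p (\<phi> (\<phi> t)) + f3 y0 (\<phi> t) * Dnq p (\<phi> t) - 0)
      = (\<phi> t - t) * f2 y0 t + f3 y0 t - f3 y0 (\<phi> t)"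
    using t1 by (simp add: Dp p_def distrib_left)
  finally have Q: "(Q has_real_derivative (\<phi> t - t) * f2 y0 t + f3 y0 t - f3 y0 (\<phi> t)) (at 0)" .
  (* The integral over the orbit of a enters the functional with the opposite sign. *)
  define \<sigma> where "\<sigma> = (if s = b then - 1 else 1 :: real)"
  define c where "c = nq_integral n q a b (\<lambda>t. ?g t 0)"
  have J: "nq_integral n q a b (\<lambda>t. ?g t e) = c + \<sigma> * Q e" for e
    using s(1) ab(3) on_s[of e] off_s[of a e] off_s[of b e]
    by (cases "s = b") (auto simp: nq_integral_def \<sigma>_def c_def)
  have "((\<lambda>e. nq_integral n q a b (\<lambda>t. ?g t e)) has_real_derivative
      \<sigma> * ((\<phi> t - t) * f2 y0 t + f3 y0 t - f3 y0 (\<phi> t))) (at 0)"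
    unfolding J using DERIV_add[OF DERIV_const DERIV_cmult[OF Q]] by simp
  then have "\<sigma> * ((\<phi> t - t) * f2 y0 t + f3 y0 t - f3 y0 (\<phi> t)) = 0"
    by (rule first_variation_eq_0[OF opt p])
  then show ?thesis
    using t1 by (simp add: \<sigma>_def quot_def field_simps split: if_splits)
qed

text \<open>
Uniformity on each of the two orbits gives uniformity on all nonzero points of \<open>A\<close>.
\<close>

lemma g_uniform_near0:
  assumes adm: "nq_admissible n q a b \<alpha> \<beta> y" and p: "nq_variation n q a b p" and "0 < \<eta>"
  shows "\<exists>\<delta>>0. \<forall>e. 0 < \<bar>e\<bar> \<and> \<bar>e\<bar> < \<delta> \<longrightarrow>
    (\<forall>\<^sub>F t in near0. \<bar>(nq_g n q a b f y p t e - nq_g n q a b f y p t 0) / e -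
      (f2 y t * p (\<phi> t) + f3 y t * Dnq p t)\<bar> < \<eta>)"
proof -
  let ?P = "\<lambda>e t. \<bar>(nq_g n q a b f y p t e - nq_g n q a b f y p t 0) / e -
      deriv (nq_g n q a b f y p t) 0\<bar> < \<eta>"
  have "\<exists>\<delta>>0. \<forall>e. 0 < \<bar>e\<bar> \<and> \<bar>e\<bar> < \<delta> \<longrightarrow> (\<forall>t\<in>nq_orbit n q s. ?P e t)" if "s \<in> {a, b}" for s
    using g_unif[OF adm p that] \<open>0 < \<eta>\<close> unfolding unif_differentiable_at_def by simp
  then obtain \<delta> where \<delta>: "\<And>s. s \<in> {a, b} \<Longrightarrow> 0 < \<delta> s"
    "\<And>s e t. \<lbrakk>s \<in> {a, b}; 0 < \<bar>e\<bar>; \<bar>e\<bar> < \<delta> s; t \<in> nq_orbit n q s\<rbrakk> \<Longrightarrow> ?P e t"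
    by metis
  have "\<forall>\<^sub>F t in near0. \<bar>(nq_g n q a b f y p t e - nq_g n q a b f y p t 0) / e -
      (f2 y t * p (\<phi> t) + f3 y t * Dnq p t)\<bar> < \<eta>" if e: "0 < \<bar>e\<bar>" "\<bar>e\<bar> < min (\<delta> a) (\<delta> b)" for e
    using eventually_near0
  proof eventually_elim
    case (elim t)
    then have "t \<in> nq_orbit n q a \<or> t \<in> nq_orbit n q b"
      by (auto simp: nq_interval_def)
    then have "?P e t" using \<delta>(2)[of a e t] \<delta>(2)[of b e t] e by auto
    then show ?case using DERIV_imp_deriv[OF g_has_derivative] elim by simp
  qed
  then show ?thesis using \<delta>(1) by (intro exI[of _ "min (\<delta> a) (\<delta> b)"]) auto
qed

text \<open>
Varying \<open>y\<close> by \<open>e\<close> times a cutoff of the constant \<open>1\<close> leaves the third argument of \<open>f\<close> unchanged near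
\<open>0\<close>.  For these variations the argument \<open>y (\<phi> t)\<close> in place of \<open>y t\<close> is just a translation of the
parameter \<open>e\<close> by \<open>y (\<phi> t) - y t\<close>, which is the shift treated by the Baire argument.
\<close>

lemma lagrangian_and_f2_limits:
  assumes ends: "0 \<notin> {a, b}" and adm: "nq_admissible n q a b \<alpha> \<beta> y"
  shows "((\<lambda>t. f t (y (\<phi> t)) (Dnq y t)) \<longlongrightarrow> f 0 (y 0) (Dnq y 0)) near0"
    and "(f2 y \<longlongrightarrow> f2 y 0) near0"
proof -
  have E: "y \<in> nq_E_space n q a b" using adm by (simp add: nq_admissible_def)
  define p where "p t = (if t \<in> {a, b} then 0 else 1 :: real)" for t
  note cut = cutoff_variation[OF ends const_in_E_space[of 1], of p, OF p_def]
  have p: "nq_variation n q a b p" and p_E: "p \<in> nq_E_space n q a b"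
    using cut(1) by (auto simp: nq_variation_def)
  have p1: "\<forall>\<^sub>F t in near0. p t = 1 \<and> Dnq p t = 0"
    using cut(2,3) eventually_near0 by eventually_elim (simp add: nq_deriv_const)
  have p1': "\<forall>\<^sub>F t in near0. p (\<phi> t) = 1"
    using eventually_compose_filterlim[OF p1 map_near0] by (auto elim: eventually_mono)
  (* The assumption on paths concerns the unshifted argument y t. *)
  let ?\<Phi> = "\<lambda>t e. f t (y t + e) (Dnq y t)"
  define \<psi> where "\<psi> e = f 0 (y 0 + e) (Dnq y 0)" for e
  have \<Phi>_lim: "((\<lambda>t. ?\<Phi> t e) \<longlongrightarrow> \<psi> e) near0" for e
  proof -
    let ?y = "\<lambda>t. y t + e * p t"
    have "((\<lambda>t. f t (?y t) (Dnq ?y t)) \<longlongrightarrow> f 0 (?y 0) (Dnq ?y 0)) near0"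
      using f_path[OF nq_admissible_perturbed[OF adm p]] by (simp add: D_space_iff)
    moreover have "f 0 (?y 0) (Dnq ?y 0) = \<psi> e"
      using cut(4,5) by (simp add: E_space_add_scaled[OF E p_E] nq_deriv_const \<psi>_def)
    moreover have "\<forall>\<^sub>F t in near0. f t (?y t) (Dnq ?y t) = ?\<Phi> t e"
      using p1 eventually_near0 by eventually_elim (simp add: E_space_add_scaled[OF E p_E])
    ultimately show ?thesis by (auto intro: Lim_transform_eventually)
  qed
  have shift: "((\<lambda>t. y (\<phi> t) - y t) \<longlongrightarrow> 0) near0"
    using tendsto_diff[OF filterlim_compose[OF E_spaceD(1)[OF E] map_near0] E_spaceD(1)[OF E]]
    by simp
  have g_eq: "\<forall>\<^sub>F t in near0. nq_g n q a b f y p t e = ?\<Phi> t (e + (y (\<phi> t) - y t))" for e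
    using p1 p1' by eventually_elim (simp add: nq_g_eq add.commute)
  have approx: "\<exists>e\<in>{l<..<r}. \<forall>\<^sub>F t in near0. \<bar>nq_g n q a b f y p t e - \<psi> e\<bar> < \<eta>"
    if "l < r" "0 < \<eta>" for l r \<eta>
  proof -
    have "\<exists>e\<in>{l<..<r}. \<forall>\<^sub>F t in near0. \<bar>?\<Phi> t (e + (y (\<phi> t) - y t)) - \<psi> e\<bar> < \<eta>"
    proof (rule Baire_shifted_limit[OF \<Phi>_lim _ _ shift that])
      show "continuous_on UNIV (\<lambda>e. f t (y t + e) (Dnq y t))" if "t \<in> A" for t
        by (intro C1_plane_continuous[where f = f] f_C1[OF that] continuous_intros)
      show "continuous_on UNIV \<psi>"
        unfolding \<psi>_def by (intro C1_plane_continuous[where f = f] f_C1 continuous_intros zero_in_A)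
    qed
    then obtain e where "e \<in> {l<..<r}"
      and e: "\<forall>\<^sub>F t in near0. \<bar>?\<Phi> t (e + (y (\<phi> t) - y t)) - \<psi> e\<bar> < \<eta>" by blast
    moreover have "\<forall>\<^sub>F t in near0. \<bar>nq_g n q a b f y p t e - \<psi> e\<bar> < \<eta>"
      using e g_eq[of e] by eventually_elim simp
    ultimately show ?thesis by blast
  qed
  have \<psi>: "(\<psi> has_real_derivative f2 y 0) (at 0)"
    using C1_plane_derivative_along_line[where f = f and t = 0, OF f_C1[OF zero_in_A], of "y 0" 1 "Dnq y 0" 0]
    by (simp add: \<psi>_def[abs_def] f2_def)
  note lims = limits_of_uniformly_differentiable_family[OF g_uniform_near0[OF adm p] approx \<psi>]
  have "\<forall>\<^sub>F t in near0. nq_g n q a b f y p t 0 = f t (y (\<phi> t)) (Dnq y t)"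
    using g_eq[of 0] by (auto elim: eventually_mono)
  with lims(1) show "((\<lambda>t. f t (y (\<phi> t)) (Dnq y t)) \<longlongrightarrow> f 0 (y 0) (Dnq y 0)) near0"
    by (auto simp: \<psi>_def intro: Lim_transform_eventually)
  have "\<forall>\<^sub>F t in near0. f2 y t * p (\<phi> t) + f3 y t * Dnq p t = f2 y t"
    using p1 p1' by eventually_elim simp
  with lims(2) show "(f2 y \<longlongrightarrow> f2 y 0) near0"
    by (rule Lim_transform_eventually)
qed

text \<open>
Varying \<open>y\<close> by \<open>e\<close> times a cutoff of the identity moves the third argument of \<open>f\<close> by \<open>e\<close> and the second
by \<open>e * \<phi> t\<close>, whose contribution disappears in the limit because \<open>f2 y\<close> has a limit there.  The limits along
the perturbed paths come from the preceding lemma, which holds for every admissible path.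
\<close>

lemma f3_limit:
  assumes ends: "0 \<notin> {a, b}" and adm: "nq_admissible n q a b \<alpha> \<beta> y"
  shows "(f3 y \<longlongrightarrow> f3 y 0) near0"
proof -
  have E: "y \<in> nq_E_space n q a b" using adm by (simp add: nq_admissible_def)
  define p where "p t = (if t \<in> {a, b} then 0 else t :: real)" for t
  note cut = cutoff_variation[OF ends id_in_E_space, of p, OF p_def]
  have p: "nq_variation n q a b p" and p_E: "p \<in> nq_E_space n q a b"
    using cut(1) by (auto simp: nq_variation_def)
  have p1: "\<forall>\<^sub>F t in near0. Dnq p t = 1"
    using cut(3) eventually_near0 by eventually_elim (simp add: nq_deriv_id)
  have p1': "\<forall>\<^sub>F t in near0. p (\<phi> t) = \<phi> t"
    using eventually_compose_filterlim[OF cut(2) map_near0] .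
  have p_0: "p 0 = 0" "Dnq p 0 = 1" using cut(4,5) by (auto simp: nq_deriv_id)
  define \<psi> where "\<psi> e = f 0 (y 0) (Dnq y 0 + e)" for e
  have g_lim: "((\<lambda>t. nq_g n q a b f y p t e) \<longlongrightarrow> \<psi> e) near0" for e
  proof -
    let ?y = "\<lambda>t. y t + e * p t"
    have "((\<lambda>t. f t (?y (\<phi> t)) (Dnq ?y t)) \<longlongrightarrow> f 0 (?y 0) (Dnq ?y 0)) near0"
      using lagrangian_and_f2_limits(1)[OF ends nq_admissible_perturbed[OF adm p]] .
    moreover have "f 0 (?y 0) (Dnq ?y 0) = \<psi> e"
      by (simp add: E_space_add_scaled[OF E p_E] p_0 \<psi>_def)
    moreover have "\<forall>\<^sub>F t in near0. f t (?y (\<phi> t)) (Dnq ?y t) = nq_g n q a b f y p t e"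
      using eventually_near0
      by eventually_elim (simp add: E_space_add_scaled[OF E p_E] nq_g_eq)
    ultimately show ?thesis by (auto intro: Lim_transform_eventually)
  qed
  have approx: "\<exists>e\<in>{l<..<r}. \<forall>\<^sub>F t in near0. \<bar>nq_g n q a b f y p t e - \<psi> e\<bar> < \<eta>"
    if "l < r" "0 < \<eta>" for l r \<eta>
    using that tendstoD[OF g_lim \<open>0 < \<eta>\<close>, of "(l + r) / 2"]
    by (intro bexI[of _ "(l + r) / 2"]) (auto simp: dist_real_def)
  have \<psi>: "(\<psi> has_real_derivative f3 y 0) (at 0)"
    using C1_plane_derivative_along_line[where f = f and t = 0, OF f_C1[OF zero_in_A], of "y 0" 0 "Dnq y 0" 1]
    by (simp add: \<psi>_def[abs_def] f3_def)
  have "((\<lambda>t. f2 y t * p (\<phi> t) + f3 y t * Dnq p t) \<longlongrightarrow> f3 y 0) near0"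
    using limits_of_uniformly_differentiable_family(2)[OF g_uniform_near0[OF adm p] approx \<psi>] .
  moreover have "((\<lambda>t. f2 y t * \<phi> t) \<longlongrightarrow> f2 y 0 * 0) near0"
    using map_near0 by (intro tendsto_mult lagrangian_and_f2_limits ends adm) (simp add: filterlim_at)
  ultimately have "((\<lambda>t. f2 y t * p (\<phi> t) + f3 y t * Dnq p t - f2 y t * \<phi> t) \<longlongrightarrow> f3 y 0 - f2 y 0 * 0) near0"
    by (rule tendsto_diff)
  moreover have "\<forall>\<^sub>F t in near0. f2 y t * p (\<phi> t) + f3 y t * Dnq p t - f2 y t * \<phi> t = f3 y t"
    using p1 p1' by eventually_elim simp
  ultimately show ?thesis by (auto intro: Lim_transform_eventually)
qed

lemma euler_lagrange:
  assumes opt: "nq_local_minimizer n q a b \<alpha> \<beta> f y0 \<or> nq_local_maximizer n q a b \<alpha> \<beta> f y0"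
    and f2: "(f2 y0 \<longlongrightarrow> f2 y0 0) near0" and f3: "(f3 y0 \<longlongrightarrow> f3 y0 0) near0"
    and "t \<in> A"
  shows "has_nq_deriv n q A (f3 y0) (f2 y0 t) t"
proof (cases "t = 0")
  case True
  have "\<forall>\<^sub>F t in near0. f2 y0 t = quot (f3 y0) t"
    using eventually_near0 by eventually_elim (simp add: euler_lagrange_nonzero[OF opt])
  with f2 have "(quot (f3 y0) \<longlongrightarrow> f2 y0 0) near0"
    by (rule Lim_transform_eventually)
  with f3 show ?thesis
    unfolding True has_nq_deriv_0 by (rule derivative_at_0_of_quotient)
next
  case False
  then show ?thesis
    using euler_lagrange_nonzero[OF opt \<open>t \<in> A\<close>] \<open>t \<in> A\<close> by (simp add: has_nq_deriv_nonzero)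
qed

end

theorem theorem27:
  fixes n :: nat and q a b \<alpha> \<beta> :: real
    and f :: "real \<Rightarrow> real \<Rightarrow> real \<Rightarrow> real" and y0 :: "real \<Rightarrow> real"
  defines "A \<equiv> nq_interval n q a b"
  assumes q: "0 < q" "q < 1" and n: "odd n"
    and ab: "a \<in> nq_I n q" "b \<in> nq_I n q" "a < b"
    and A1: "\<And>t. t \<in> A \<Longrightarrow> C1_plane (\<lambda>(u, v). f t u v)"
    and A2: "\<And>y h. \<lbrakk>nq_admissible n q a b \<alpha> \<beta> y; h \<in> {f, partial2 f, partial3 f}\<rbrakk> \<Longrightarrow>
               (\<lambda>t. h t (y t) (nq_deriv n q A y t)) \<in> nq_D_space n q a b"
    and A3: "\<And>y p s. \<lbrakk>nq_admissible n q a b \<alpha> \<beta> y; nq_variation n q a b p; s \<in> {a, b}\<rbrakk> \<Longrightarrow>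
               unif_differentiable_at (nq_orbit n q s) (nq_g n q a b f y p) 0"
    and A4: "\<And>y p s. \<lbrakk>nq_admissible n q a b \<alpha> \<beta> y; nq_variation n q a b p; s \<in> {a, b}\<rbrakk> \<Longrightarrow>
               \<forall>\<^sub>F e in nhds 0. nq_integrable0 n q s (\<lambda>t. nq_g n q a b f y p t e)"
    and A5: "\<And>y p s. \<lbrakk>nq_admissible n q a b \<alpha> \<beta> y; nq_variation n q a b p; s \<in> {a, b}\<rbrakk> \<Longrightarrow>
               nq_integrable0 n q s (\<lambda>t. deriv (nq_g n q a b f y p t) 0)"
    and orbits: "nq_orbit n q a \<inter> nq_orbit n q b \<subseteq> {0}"
    and endpoint0: "\<And>h. \<lbrakk>0 \<in> {a, b}; h \<in> {partial2 f, partial3 f}\<rbrakk> \<Longrightarrow>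
               continuous_on A (\<lambda>t. h t (y0 (q * t ^ n)) (nq_deriv n q A y0 t))"
    and optimal: "nq_local_minimizer n q a b \<alpha> \<beta> f y0 \<or> nq_local_maximizer n q a b \<alpha> \<beta> f y0"
  shows "\<forall>t\<in>A.
           nq_differentiable n q A (\<lambda>s. partial3 f s (y0 (q * s ^ n)) (nq_deriv n q A y0 s)) t \<and>
           nq_deriv n q A (\<lambda>s. partial3 f s (y0 (q * s ^ n)) (nq_deriv n q A y0 s)) t =
             partial2 f t (y0 (q * t ^ n)) (nq_deriv n q A y0 t)"
proof -
  interpret nq_problem n q a b \<alpha> \<beta> f
    using q n ab orbits A1 A2[of _ f] A3 A4 unfolding A_def by unfold_locales auto
  have f2_eq: "f2 y0 = (\<lambda>t. partial2 f t (y0 (q * t ^ n)) (nq_deriv n q A y0 t))"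
    and f3_eq: "f3 y0 = (\<lambda>t. partial3 f t (y0 (q * t ^ n)) (nq_deriv n q A y0 t))"
    by (auto simp: f2_def f3_def nq_map_def A_def fun_eq_iff)
  have adm: "nq_admissible n q a b \<alpha> \<beta> y0"
    using optimal by (auto simp: nq_local_minimizer_def nq_local_maximizer_def)
  have "(f2 y0 \<longlongrightarrow> f2 y0 0) near0 \<and> (f3 y0 \<longlongrightarrow> f3 y0 0) near0"
  proof (cases "0 \<in> {a, b}")
    case True
    have "continuous_on A (f2 y0)" "continuous_on A (f3 y0)"
      unfolding f2_eq f3_eq by (rule endpoint0[OF True]; simp)+
    then show ?thesis by (simp add: continuous_on_def A_def)
  next
    case False
    then show ?thesis using lagrangian_and_f2_limits(2) f3_limit adm by blast
  qed
  then have EL: "has_nq_deriv n q A (f3 y0) (f2 y0 t) t" if "t \<in> A" for t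
    using euler_lagrange[OF optimal] that unfolding A_def by blast
  have unique: "nq_deriv n q A (f3 y0) t = f2 y0 t" if "t \<in> A" for t
    using EL[OF that] that unfolding A_def
    by (cases "t = 0") (auto simp: has_nq_deriv_0 has_nq_deriv_nonzero nq_deriv_0 nq_deriv_nonzero)
  show ?thesis
    using EL unique unfolding nq_differentiable_def f2_eq f3_eq by blast
qed

end
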